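(* Let $\Delta\ge 4$ be an integer and let $G$ be a connected graph of maximum degree at most $\Delta$. \begin{itemize} \item If $\Delta\neq 5$, then $G$ has an independent dominating set of size at most $\bigl(1-\frac{\Delta}{\lfloor \Delta^2/4\rfloor+\Delta}\bigr)(\lvert V(G)\rvert-1)+1$. \item If $\Delta=5$, then $G$ has an independent dominating set of size at most $\max\left(\frac{5}{9}\lvert V(G)\rvert,\ \bigl(1-\frac{\Delta}{\lfloor \Delta^2/4\rfloor+\Delta}\bigr)(\lvert V(G)\rvert-1)+1\right)$. \end{itemize}
   Context: All graphs are finite and simple. An independent dominating set of a graph is a set $S$ of pairwise non-adjacent vertices such that every vertex not in $S$ has a neighbor in $S$ (equivalently, a maximal independent set). *)

theory Defs
  imports Complex_Main "Graph_Theory.Graph_Theory"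
begin

text \<open>
  A finite simple graph is a \<^locale>\<open>pair_graph\<close>: a finite, symmetric, loop-free digraph whose arcs
  are ordered pairs of vertices. Each edge is represented by both of its orientations, so the
  neighbours of a vertex are its out-neighbours and its degree is its out-degree.
  The library notion \<^const>\<open>Digraph_Component.connected\<close> requires at least one vertex.
\<close>

definition max_degree :: "'a pair_pre_digraph \<Rightarrow> nat" where
  "max_degree G = Max (out_degree (with_proj G) ` pverts G)"

definition independent_set :: "'a pair_pre_digraph \<Rightarrow> 'a set \<Rightarrow> bool" where
  "independent_set G S \<longleftrightarrow>
     S \<subseteq> pverts G \<and> (\<forall>u\<in>S. \<forall>v\<in>S. \<not> u \<rightarrow>\<^bsub>with_proj G\<^esub> v)"

definition dominating_set :: "'a pair_pre_digraph \<Rightarrow> 'a set \<Rightarrow> bool" where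
  "dominating_set G S \<longleftrightarrow>
     S \<subseteq> pverts G \<and> (\<forall>v \<in> pverts G - S. \<exists>u\<in>S. v \<rightarrow>\<^bsub>with_proj G\<^esub> u)"

definition independent_dominating_set :: "'a pair_pre_digraph \<Rightarrow> 'a set \<Rightarrow> bool" where
  "independent_dominating_set G S \<longleftrightarrow> independent_set G S \<and> dominating_set G S"

end

theory Submission
  imports Defs
begin

text \<open>
  Partition the vertices into nontrivial stars with set of hubs \<open>X\<close>, and let \<open>m x\<close> be the number of
  leaves of the hub \<open>x\<close>. A maximal independent set \<open>I\<close> of the graph induced on \<open>X\<close> extends, by at
  most one vertex per leaf outside the stars of \<open>I\<close>, to an independent dominating set, so the task
  is to make the total weight \<open>m x - 1\<close> of \<open>I\<close> large. With \<open>f = \<Delta>\<^sup>2 div 4\<close>, choosing greedily a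
  hub of largest weight pays \<open>\<Delta> * m x - f\<close> for every vertex of its closed neighbourhood out of the
  gain \<open>(f + \<Delta>) * (m h - 1)\<close>, except when all vertices in sight have the same \<open>m = M\<close>, with
  \<open>M\<^sup>2 + f = \<Delta> * M\<close>, and have degree exactly \<open>\<Delta> - M\<close> in \<open>X\<close> (a tight set). A tight set loses
  \<open>\<Delta>\<close>, once. Let \<open>d\<close> be the distance to a root \<open>r\<close>; a star partition that minimises the sum of \<open>4 ^ d\<close>
  over the hubs of all vertices has the hub of \<open>r\<close> in every tight set, since otherwise a leaf of the
  tight set could be moved to a star closer to \<open>r\<close>. So the loss occurs only once in total.

  For \<open>\<Delta> = 5\<close> a slack vertex with two leaves is no longer paid for by this measure, but it is by the
  one that belongs to \<open>5 / 9\<close>. There only tight cliques lose, because a cubic graph without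
  \<open>K\<^sub>4\<close> has an independent set \<open>J\<close> whose closed neighbourhood has at most \<open>3 * card J\<close> vertices. If
  no star partition avoids tight cliques, then moving the tight clique around shows that in a
  suitable partition all hubs lie in cliques that are tight up to one leaf, and the bound is exact
  on each of them.
\<close>

subsection \<open>Greedy maximal independent sets\<close>

locale sgraph =
  fixes E :: "'a \<Rightarrow> 'a \<Rightarrow> bool"
  assumes adj_sym: "E u v \<Longrightarrow> E v u"
    and adj_irrefl: "\<not> E v v"
begin

lemma adj_commute: "E u v \<longleftrightarrow> E v u"
  using adj_sym by blast

definition nb :: "'a set \<Rightarrow> 'a \<Rightarrow> 'a set" where
  "nb U u = {v \<in> U. E u v}"

definition cnb :: "'a set \<Rightarrow> 'a set \<Rightarrow> 'a set" where
  "cnb U J = J \<union> (\<Union>u\<in>J. nb U u)"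

definition indep :: "'a set \<Rightarrow> bool" where
  "indep I \<longleftrightarrow> (\<forall>u\<in>I. \<forall>v\<in>I. \<not> E u v)"

definition max_indep :: "'a set \<Rightarrow> 'a set \<Rightarrow> bool" where
  "max_indep U I \<longleftrightarrow> I \<subseteq> U \<and> indep I \<and> (\<forall>v\<in>U - I. \<exists>u\<in>I. E v u)"

definition closed_in :: "'a set \<Rightarrow> 'a set \<Rightarrow> bool" where
  "closed_in U Q \<longleftrightarrow> Q \<subseteq> U \<and> (\<forall>u\<in>Q. nb U u \<subseteq> Q)"

lemma nb_subset: "nb U u \<subseteq> U"
  by (auto simp: nb_def)

lemma finite_nb [simp]: "finite U \<Longrightarrow> finite (nb U u)"
  by (simp add: nb_def)

lemma nb_notin [simp]: "u \<notin> nb U u"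
  by (simp add: nb_def adj_irrefl)

lemma nb_mono: "W \<subseteq> U \<Longrightarrow> nb W u \<subseteq> nb U u"
  by (auto simp: nb_def)

lemma cnb_singleton [simp]: "cnb U {h} = insert h (nb U h)"
  by (auto simp: cnb_def)

lemma cnb_subset: "J \<subseteq> U \<Longrightarrow> cnb U J \<subseteq> U"
  by (auto simp: cnb_def nb_def)

lemma indep_singleton [simp]: "indep {h}"
  by (simp add: indep_def adj_irrefl)

lemma max_indep_extend:
  assumes "J \<subseteq> U" "indep J" "max_indep (U - cnb U J) I"
  shows "max_indep U (J \<union> I)" "J \<inter> I = {}"
proof -
  have sep: "\<not> E u v" if "u \<in> J" "v \<in> I" for u v
    using that assms(3) by (auto simp: max_indep_def cnb_def nb_def)
  then have "indep (J \<union> I)"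
    using assms(2,3) adj_sym unfolding indep_def max_indep_def by (metis Un_iff)
  moreover have "\<exists>u\<in>J \<union> I. E v u" if v: "v \<in> U - (J \<union> I)" for v
  proof (cases "v \<in> cnb U J")
    case True
    then obtain u where "u \<in> J" "E u v" using v by (auto simp: cnb_def nb_def)
    then show ?thesis using adj_sym by blast
  next
    case False
    then show ?thesis using v assms(3) by (auto simp: max_indep_def)
  qed
  ultimately show "max_indep U (J \<union> I)"
    using assms by (auto simp: max_indep_def)
  show "J \<inter> I = {}"
    using assms(3) by (auto simp: max_indep_def cnb_def)
qed

text \<open>The sets \<open>cnb W J\<close> removed one after another partition \<open>U\<close>,
  and the disjoint sets \<open>J\<close> unite to a maximal independent set, so the local
  inequalities add up. The invariant \<open>P\<close> carries along what the local step has to know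
  about the remaining vertices.\<close>

lemma greedy_max_indep:
  fixes gain cost :: "'a \<Rightarrow> int"
  assumes "finite U" "P U"
    and step: "\<And>W. W \<subseteq> U \<Longrightarrow> W \<noteq> {} \<Longrightarrow> P W \<Longrightarrow>
      \<exists>J. J \<noteq> {} \<and> J \<subseteq> W \<and> indep J \<and> sum cost (cnb W J) \<le> sum gain J \<and> P (W - cnb W J)"
  shows "\<exists>I. max_indep U I \<and> sum cost U \<le> sum gain I"
proof -
  have "\<exists>I. max_indep W I \<and> sum cost W \<le> sum gain I" if "W \<subseteq> U" "P W" for W
    using finite_subset[OF that(1) assms(1)] that
  proof (induction W rule: finite_psubset_induct)
    case (psubset W)
    show ?case
    proof (cases "W = {}")
      case True
      then show ?thesis by (intro exI[of _ "{}"]) (simp add: max_indep_def indep_def)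
    next
      case False
      then obtain J where J: "J \<noteq> {}" "J \<subseteq> W" "indep J" "sum cost (cnb W J) \<le> sum gain J" 
        "P (W - cnb W J)"
        using step[OF psubset.prems(1) False psubset.prems(2)] by blast
      have "J \<subseteq> cnb W J" by (auto simp: cnb_def)
      then have "W - cnb W J \<subset> W" using J(1,2) by blast
      then obtain I where I: "max_indep (W - cnb W J) I" "sum cost (W - cnb W J) \<le> sum gain I"
        using psubset.IH J(5) psubset.prems(1) by blast
      have fin: "finite J" "finite I"
        using finite_subset[OF J(2) psubset.hyps] finite_subset[of I W] I(1) psubset.hyps
        by (auto simp: max_indep_def)
      have "sum cost W = sum cost (cnb W J) + sum cost (W - cnb W J)"
        using sum.subset_diff[OF cnb_subset[OF J(2)] psubset.hyps, of cost] by simp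
      also have "\<dots> \<le> sum gain (J \<union> I)"
        using J(4) I(2) max_indep_extend(2)[OF J(2,3) I(1)] fin by (simp add: sum.union_disjoint)
      finally show ?thesis using max_indep_extend(1)[OF J(2,3) I(1)] by blast
    qed
  qed
  then show ?thesis using assms(2) by blast
qed

lemma max_indep_exists:
  assumes "finite U"
  shows "\<exists>I. max_indep U I"
proof -
  have "\<exists>I. max_indep U I \<and> sum (\<lambda>_. 0 :: int) U \<le> sum (\<lambda>_. 0) I"
  proof (rule greedy_max_indep[where P = "\<lambda>_. True"])
    fix W :: "'a set" assume "W \<noteq> {}"
    then obtain h where "h \<in> W" by blast
    then show "\<exists>J. J \<noteq> {} \<and> J \<subseteq> W \<and> indep J \<and>
        sum (\<lambda>_. 0 :: int) (cnb W J) \<le> sum (\<lambda>_. 0) J \<and> True"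
      by (intro exI[of _ "{h}"]) simp
  qed (use assms in auto)
  then show ?thesis by blast
qed

end

subsection \<open>Weighted greedy choice and tight sets\<close>

context sgraph begin

text \<open>The equation for \<open>M\<close> is the case of equality in
  \<open>four_quarter_square\<close>; its solutions are \<open>D / 2\<close> rounded up or down. All
  vertices of a tight set exhaust the degree budget, and the closed neighbourhood of any of them
  costs exactly \<open>D\<close> more than the vertex gains.\<close>

definition tight_set :: "('a \<Rightarrow> nat) \<Rightarrow> nat \<Rightarrow> 'a set \<Rightarrow> 'a set \<Rightarrow> bool" where
  "tight_set m D U Q \<longleftrightarrow> Q \<noteq> {} \<and> closed_in U Q \<and>
     (\<exists>M. M\<^sup>2 + D\<^sup>2 div 4 = D * M \<and> (\<forall>u\<in>Q. m u = M \<and> M + card (nb U u) = D))"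

lemma nb_eq_of_full:
  assumes "finite U" "W \<subseteq> U" "m + card (nb U u) \<le> D" "m + card (nb W u) = D"
  shows "nb W u = nb U u"
  using assms nb_mono[OF assms(2), of u] by (intro card_seteq) auto

text \<open>A vertex that attains the bound \<open>D\<close> already inside \<open>W\<close> has no
  neighbour in \<open>U - W\<close>. Hence removing vertices never creates a tight set, and the
  absence of tight sets survives the greedy choice.\<close>

lemma tight_set_mono:
  assumes "finite U" "W \<subseteq> U" "\<And>u. u \<in> U \<Longrightarrow> m u + card (nb U u) \<le> D" "tight_set m D W Q"
  shows "tight_set m D U Q"
proof -
  obtain M where M: "M\<^sup>2 + D\<^sup>2 div 4 = D * M" "\<And>u. u \<in> Q \<Longrightarrow> m u = M \<and> M + card (nb W u) = D"
    and Q: "Q \<noteq> {}" "Q \<subseteq> W" "\<And>u. u \<in> Q \<Longrightarrow> nb W u \<subseteq> Q"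
    using assms(4) unfolding tight_set_def closed_in_def by blast
  have eq: "nb W u = nb U u" if "u \<in> Q" for u
    using nb_eq_of_full[OF assms(1,2), of M u D] M(2)[OF that] assms(3)[of u] that Q(2) assms(2) by auto
  show ?thesis
    unfolding tight_set_def closed_in_def
    using Q M eq assms(2) by (intro conjI exI[of _ M]) auto
qed

section \<open>Cost of a closed neighbourhood, and the tight values\<close>

lemma sum_cost_cnb_le:
  fixes cost :: "'a \<Rightarrow> int"
  assumes "finite U" "\<And>v. v \<in> insert h (nb U h) \<Longrightarrow> cost v \<le> K"
  shows "sum cost (insert h (nb U h)) \<le> (int (card (nb U h)) + 1) * K"
proof -
  have "sum cost (insert h (nb U h)) \<le> of_nat (card (insert h (nb U h))) * K"
    by (rule sum_bounded_above) (rule assms(2))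
  then show ?thesis using assms(1) by (simp add: algebra_simps)
qed

lemma sum_cost_cnb_less:
  fixes cost :: "'a \<Rightarrow> int"
  assumes "finite U" "\<And>v. v \<in> insert h (nb U h) \<Longrightarrow> cost v \<le> K"
    and w: "w \<in> insert h (nb U h)" "cost w \<le> K - c"
  shows "sum cost (insert h (nb U h)) \<le> (int (card (nb U h)) + 1) * K - c"
proof -
  have fin: "finite (insert h (nb U h))" using assms(1) by simp
  have "sum cost (insert h (nb U h) - {w}) \<le> of_nat (card (insert h (nb U h) - {w})) * K"
    using assms(2) by (intro sum_bounded_above) auto
  also have "card (insert h (nb U h) - {w}) = card (nb U h)" using w fin assms(1) by simp
  finally have "sum cost (insert h (nb U h) - {w}) \<le> int (card (nb U h)) * K" .
  then show ?thesis
    using w(2) sum.remove[OF fin w(1), of cost] by (simp add: algebra_simps)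
qed

text \<open>Four times the difference of the two sides is \<open>(2 * M - D)\<^sup>2\<close> minus
  the remainder of \<open>D\<^sup>2\<close> modulo 4. That remainder is 0 for even \<open>D\<close>
  and 1 for odd \<open>D\<close>, and in the odd case the square is at least 1.\<close>

lemma four_quarter_square:
  fixes D M :: nat
  defines "f \<equiv> D\<^sup>2 div 4"
  shows "int D * int M \<le> (int M)\<^sup>2 + int f"
proof -
  have f: "4 * int f = (int D)\<^sup>2 - int (D\<^sup>2 mod 4)"
    unfolding f_def using div_mult_mod_eq[of "D\<^sup>2" 4] by (metis add_diff_cancel_right' mult.commute of_nat_add of_nat_mult of_nat_numeral of_nat_power)
  have "int (D\<^sup>2 mod 4) \<le> (2 * int M - int D)\<^sup>2"
  proof (cases "even D")
    case True
    then have "D\<^sup>2 mod 4 = 0" by (auto elim!: evenE simp: power2_eq_square)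
    then show ?thesis by simp
  next
    case False
    then obtain k where k: "D = 2 * k + 1" by (auto elim: oddE)
    have "D\<^sup>2 = 4 * (k\<^sup>2 + k) + 1" by (simp add: k power2_eq_square algebra_simps)
    then have "D\<^sup>2 mod 4 = 1" by presburger
    moreover have "2 * int M - int D \<noteq> 0" unfolding k by presburger
    then have "0 < (2 * int M - int D)\<^sup>2" by simp
    ultimately show ?thesis by linarith
  qed
  then have "4 * (int D * int M) \<le> 4 * ((int M)\<^sup>2 + int f)"
    using f by (simp add: power2_eq_square algebra_simps)
  then show ?thesis by simp
qed

text \<open>Solving the quadratic equation for each parity of \<open>D\<close> shows that
  \<open>M\<close> is \<open>D / 2\<close> rounded down or up. The second inequality fails for
  \<open>D = 5\<close>, \<open>M = 2\<close>; this is where 5 becomes exceptional.\<close>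

lemma tight_value_ge:
  fixes D M :: nat
  assumes "4 \<le> D" "M\<^sup>2 + D\<^sup>2 div 4 = D * M"
  shows "2 \<le> M" "D \<noteq> 5 \<Longrightarrow> D \<le> M\<^sup>2"
proof -
  obtain k where k: "D = 2 * k \<and> M = k \<or> D = 2 * k + 1 \<and> (M = k \<or> M = k + 1)"
  proof (cases "even D")
    case True
    then obtain k where D: "D = 2 * k" by (auto elim: evenE)
    have "D\<^sup>2 div 4 = k\<^sup>2" by (simp add: D power2_eq_square)
    then have "(int M - int k)\<^sup>2 = 0"
      using arg_cong[OF assms(2), of int] by (simp add: D power2_eq_square algebra_simps)
    then show ?thesis using that[of k] D by simp
  next
    case False
    then obtain k where D: "D = 2 * k + 1" by (auto elim: oddE)
    have "D\<^sup>2 = 4 * (k\<^sup>2 + k) + 1" by (simp add: D power2_eq_square algebra_simps)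
    then have "D\<^sup>2 div 4 = k\<^sup>2 + k" by presburger
    then have "(int M - int k) * (int M - int k - 1) = 0"
      using arg_cong[OF assms(2), of int] by (simp add: D power2_eq_square algebra_simps)
    then have "int M = int k \<or> int M = int k + 1" by auto
    then show ?thesis using that[of k] D by linarith
  qed
  then show "2 \<le> M" using assms(1) by auto
  show "D \<le> M\<^sup>2" if "D \<noteq> 5"
  proof -
    have "2 * k \<le> k * k" if "2 \<le> k" using that by simp
    moreover have "2 * k + 1 \<le> k * k" if "3 \<le> k"
    proof -
      have "3 * k \<le> k * k" using that by simp
      then show ?thesis using that by linarith
    qed
    moreover have "2 \<le> k" "D = 2 * k + 1 \<Longrightarrow> 3 \<le> k" using k assms(1) \<open>D \<noteq> 5\<close> by auto
    ultimately show ?thesis using k by (auto simp: power2_eq_square)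
  qed
qed

text \<open>A vertex of largest weight \<open>M\<close> is chosen. If \<open>M\<close> is not a
  tight value, the slack in \<open>four_quarter_square\<close> pays for the neighbourhood. If it is,
  the set of vertices of weight \<open>M\<close> is not tight, so one of them has a lighter
  neighbour, which saves at least \<open>D\<close>, or one neighbour fewer than allowed, which saves
  at least \<open>t = M\<^sup>2 \<ge> D\<close>.\<close>

lemma greedy_step_not_tight:
  fixes m :: "'a \<Rightarrow> nat" and D :: nat
  defines "f \<equiv> int (D\<^sup>2 div 4)"
  assumes U: "finite U" "U \<noteq> {}" and D: "4 \<le> D" "D \<noteq> 5"
    and m: "\<And>u. u \<in> U \<Longrightarrow> 1 \<le> m u" "\<And>u. u \<in> U \<Longrightarrow> m u + card (nb U u) \<le> D"
    and nt: "\<And>Q. \<not> tight_set m D U Q"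
  shows "\<exists>h\<in>U. (\<Sum>v\<in>insert h (nb U h). int D * int (m v) - f) \<le> (f + int D) * (int (m h) - 1)"
proof -
  define M where "M = Max (m ` U)"
  have M_ge: "m u \<le> M" if "u \<in> U" for u using that U by (simp add: M_def)
  have "M \<in> m ` U" unfolding M_def using U by (intro Max_in) auto
  then obtain h0 where h0: "h0 \<in> U" "m h0 = M" by blast
  define t where "t = int D * int M - f"
  have cost_le: "int D * int (m v) - f \<le> t" if "v \<in> U" for v
    using M_ge[OF that] by (simp add: t_def mult_left_mono)
  have M1: "1 \<le> M" using m(1)[OF h0(1)] h0(2) by simp
  \<comment> \<open>The left side is the largest possible cost. The last bracket is the slack in
    \<open>four_quarter_square\<close>: slack 0 leaves a deficit of exactly \<open>D\<close>, slack
    at least 1 leaves none.\<close>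
  have id: "(int D - int M + 1) * t
      = (f + int D) * (int M - 1) + int D - int D * ((int M)\<^sup>2 - int D * int M + f)"
    by (simp add: t_def power2_eq_square algebra_simps)
  have sum_le: "(\<Sum>v\<in>insert h (nb U h). int D * int (m v) - f) \<le> (int (card (nb U h)) + 1) * t" if "h \<in> U" for h
    using that U nb_subset[of U h] cost_le by (intro sum_cost_cnb_le) auto
  have deg_le: "int (card (nb U h)) + 1 \<le> int D - int M + 1" if "h \<in> U" "m h = M" for h
    using m(2)[OF that(1)] that(2) by linarith
  show ?thesis
  proof (cases "t \<le> 0")
    case True
    have "(int (card (nb U h0)) + 1) * t \<le> 0" using True by (simp add: mult_nonneg_nonpos)
    also have "0 \<le> (f + int D) * (int M - 1)" using M1 by (simp add: f_def)
    finally show ?thesis using sum_le[OF h0(1)] h0 by force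
  next
    case False
    show ?thesis
    proof (cases "M\<^sup>2 + D\<^sup>2 div 4 = D * M")
      case eq: True
      have tM: "t = (int M)\<^sup>2" using arg_cong[OF eq, of int] by (simp add: t_def f_def)
      have tD: "int D \<le> t" using tight_value_ge(2)[OF D(1) eq D(2)] tM by (metis of_nat_le_iff of_nat_power)
      have id': "(int D - int M + 1) * t = (f + int D) * (int M - 1) + int D"
        using id tM t_def by simp
      define Q where "Q = {u \<in> U. m u = M}"
      have "\<not> tight_set m D U Q" by (rule nt)
      moreover have "Q \<noteq> {}" "Q \<subseteq> U" using h0 by (auto simp: Q_def)
      ultimately obtain h where h: "h \<in> U" "m h = M" 
        and hh: "M + card (nb U h) \<noteq> D \<or> \<not> nb U h \<subseteq> Q"
        unfolding tight_set_def closed_in_def using eq by (auto simp: Q_def)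
      have "(\<Sum>v\<in>insert h (nb U h). int D * int (m v) - f) \<le> (int D - int M + 1) * t - int D"
      proof (cases "M + card (nb U h) = D")
        case True
        then obtain w where w: "w \<in> nb U h" "m w \<noteq> M" using hh nb_subset[of U h] by (auto simp: Q_def)
        then have "m w < M" using M_ge nb_subset[of U h] by (metis le_neq_implies_less subsetD)
        then have "int (m w) \<le> int M - 1" by linarith
        then have "int D * int (m w) - f \<le> int D * (int M - 1) - f" by (intro diff_right_mono mult_left_mono) auto
        then have cw: "int D * int (m w) - f \<le> t - int D" by (simp add: t_def algebra_simps)
        have "(\<Sum>v\<in>insert h (nb U h). int D * int (m v) - f) \<le> (int (card (nb U h)) + 1) * t - int D"
        proof (rule sum_cost_cnb_less[where w = w, OF U(1)])
          show "int D * int (m v) - f \<le> t" if "v \<in> insert h (nb U h)" for v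
            using that h(1) nb_subset[of U h] cost_le by blast
        qed (use w cw in auto)
        also have "\<dots> = (int D - int M + 1) * t - int D" using True by (simp add: algebra_simps flip: True)
        finally show ?thesis .
      next
        case nf: False
        then have "int (card (nb U h)) + 1 \<le> int D - int M" using m(2)[OF h(1)] h(2) by linarith
        then have "(int (card (nb U h)) + 1) * t \<le> (int D - int M) * t" using False by (intro mult_right_mono) auto
        also have "\<dots> \<le> (int D - int M + 1) * t - int D" using tD by (simp add: algebra_simps)
        finally show ?thesis using sum_le[OF h(1)] by linarith
      qed
      then show ?thesis using id' h by (intro bexI[of _ h]) auto
    next
      case ne: False
      have "(int M)\<^sup>2 + f \<noteq> int D * int M"
        using ne by (metis f_def of_nat_add of_nat_eq_iff of_nat_mult of_nat_power)
      then have "1 \<le> (int M)\<^sup>2 - int D * int M + f" using four_quarter_square[of D M] by (simp add: f_def)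
      then have "int D * 1 \<le> int D * ((int M)\<^sup>2 - int D * int M + f)" by (intro mult_left_mono) auto
      then have "(int D - int M + 1) * t \<le> (f + int D) * (int M - 1)" using id by linarith
      moreover have "(int (card (nb U h0)) + 1) * t \<le> (int D - int M + 1) * t"
        using deg_le[OF h0] False by (intro mult_right_mono) auto
      ultimately show ?thesis using sum_le[OF h0(1)] h0 by (intro bexI[of _ h0]) auto
    qed
  qed
qed

lemma weighted_greedy_not_tight:
  fixes m :: "'a \<Rightarrow> nat" and D :: nat
  defines "f \<equiv> int (D\<^sup>2 div 4)"
  assumes U: "finite U" and D: "4 \<le> D" "D \<noteq> 5"
    and m: "\<And>u. u \<in> U \<Longrightarrow> 1 \<le> m u" "\<And>u. u \<in> U \<Longrightarrow> m u + card (nb U u) \<le> D"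
    and nt: "\<And>Q. \<not> tight_set m D U Q"
  shows "\<exists>I. max_indep U I \<and>
    (\<Sum>u\<in>U. int D * int (m u) - f) \<le> (\<Sum>h\<in>I. (f + int D) * (int (m h) - 1))"
proof (rule greedy_max_indep[where P = "\<lambda>_. True", OF U])
  fix W assume W: "W \<subseteq> U" "W \<noteq> {}"
  have finW: "finite W" using W(1) U by (rule finite_subset)
  have "m u + card (nb W u) \<le> D" if "u \<in> W" for u
    using m(2)[of u] that W card_mono[OF finite_nb[OF U] nb_mono[OF W(1)], of u] by fastforce
  moreover have "\<not> tight_set m D W Q" for Q
    using tight_set_mono[OF U W(1) m(2)] nt by blast
  moreover have "1 \<le> m u" if "u \<in> W" for u using m(1) W(1) that by blast
  ultimately have "\<exists>h\<in>W. (\<Sum>v\<in>insert h (nb W h). int D * int (m v) - f) \<le> (f + int D) * (int (m h) - 1)"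
    unfolding f_def by (intro greedy_step_not_tight[OF finW W(2) D, of m])
  then obtain h where "h \<in> W"
    "(\<Sum>v\<in>insert h (nb W h). int D * int (m v) - f) \<le> (f + int D) * (int (m h) - 1)" by blast
  then show "\<exists>J. J \<noteq> {} \<and> J \<subseteq> W \<and> indep J \<and>
      (\<Sum>u\<in>cnb W J. int D * int (m u) - f) \<le> (\<Sum>h\<in>J. (f + int D) * (int (m h) - 1)) \<and> True"
    by (intro exI[of _ "{h}"]) simp
qed simp

text \<open>The additive term pays for the first choice, made inside a tight set; after that choice no
  tight set is left.\<close>

lemma weighted_greedy:
  fixes m :: "'a \<Rightarrow> nat" and D :: nat
  defines "f \<equiv> int (D\<^sup>2 div 4)"
  assumes U: "finite U" and D: "4 \<le> D" "D \<noteq> 5"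
    and m: "\<And>u. u \<in> U \<Longrightarrow> 1 \<le> m u" "\<And>u. u \<in> U \<Longrightarrow> m u + card (nb U u) \<le> D"
    and c: "\<And>Q. tight_set m D U Q \<Longrightarrow> c \<in> Q"
  shows "\<exists>I. max_indep U I \<and>
    (\<Sum>u\<in>U. int D * int (m u) - f) \<le> (\<Sum>h\<in>I. (f + int D) * (int (m h) - 1)) + int D"
proof (cases "\<exists>Q. tight_set m D U Q")
  case False
  then obtain I where "max_indep U I"
    "(\<Sum>u\<in>U. int D * int (m u) - f) \<le> (\<Sum>h\<in>I. (f + int D) * (int (m h) - 1))"
    using weighted_greedy_not_tight[OF U D m] unfolding f_def by blast
  then show ?thesis by (intro exI[of _ I]) auto
next
  case True
  then obtain Q where Q: "tight_set m D U Q" by blast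
  then have cQ: "c \<in> Q" by (rule c)
  obtain M where M: "M\<^sup>2 + D\<^sup>2 div 4 = D * M" "\<And>u. u \<in> Q \<Longrightarrow> m u = M \<and> M + card (nb U u) = D"
    and Q': "Q \<subseteq> U" "\<And>u. u \<in> Q \<Longrightarrow> nb U u \<subseteq> Q"
    using Q unfolding tight_set_def closed_in_def by blast
  define A where "A = insert c (nb U c)"
  have A: "A \<subseteq> Q" using Q'(2) cQ by (auto simp: A_def)
  have cardA: "int (card A) = int D - int M + 1"
    using M(2)[OF cQ] U by (simp add: A_def flip: of_nat_add)
  have "(\<Sum>u\<in>A. int D * int (m u) - f) = (\<Sum>u\<in>A. int D * int M - f)"
    using M(2) A by (intro sum.cong) auto
  also have "\<dots> = (int D - int M + 1) * (int D * int M - f)" using cardA by simp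
  also have "\<dots> = (f + int D) * (int M - 1) + int D"
  proof -
    have "(int M)\<^sup>2 + f = int D * int M" unfolding f_def using arg_cong[OF M(1), of int] by simp
    then have f_eq: "f = int D * int M - int M * int M" by (simp add: power2_eq_square)
    show ?thesis unfolding f_eq by (simp add: algebra_simps)
  qed
  finally have sumA: "(\<Sum>u\<in>A. int D * int (m u) - f) = (f + int D) * (int (m c) - 1) + int D"
    using M(2)[OF cQ] by simp
  define W where "W = U - cnb U {c}"
  have WU: "W \<subseteq> U" and finW: "finite W" using U by (auto simp: W_def)
  have "m u + card (nb W u) \<le> D" if "u \<in> W" for u
    using m(2)[of u] that WU card_mono[OF finite_nb[OF U] nb_mono[OF WU], of u] by fastforce
  \<comment> \<open>A set that is tight in \<open>W\<close> is tight in \<open>U\<close> as well and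
    would contain \<open>c\<close>, which has been removed.\<close>
  moreover have "\<not> tight_set m D W R" for R
  proof
    assume R: "tight_set m D W R"
    then have "c \<in> R" using tight_set_mono[OF U WU m(2) R] c by blast
    then show False using R by (auto simp: tight_set_def closed_in_def W_def)
  qed
  moreover have "1 \<le> m u" if "u \<in> W" for u using m(1) WU that by blast
  ultimately have "\<exists>I. max_indep W I \<and>
      (\<Sum>u\<in>W. int D * int (m u) - f) \<le> (\<Sum>h\<in>I. (f + int D) * (int (m h) - 1))"
    unfolding f_def by (intro weighted_greedy_not_tight[OF finW D, of m])
  then obtain I where I: "max_indep W I"
    "(\<Sum>u\<in>W. int D * int (m u) - f) \<le> (\<Sum>h\<in>I. (f + int D) * (int (m h) - 1))" by blast
  have cU: "{c} \<subseteq> U" using cQ Q'(1) by auto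
  have finI: "finite I" using I(1) finite_subset[OF _ finW] by (simp add: max_indep_def)
  have "c \<notin> I" using max_indep_extend(2)[OF cU indep_singleton] I(1) by (auto simp: W_def)
  then have "(\<Sum>h\<in>{c} \<union> I. (f + int D) * (int (m h) - 1))
      = (f + int D) * (int (m c) - 1) + (\<Sum>h\<in>I. (f + int D) * (int (m h) - 1))"
    using finI by simp
  moreover have "(\<Sum>u\<in>U. int D * int (m u) - f) = (\<Sum>u\<in>W. int D * int (m u) - f) + (\<Sum>u\<in>A. int D * int (m u) - f)"
    unfolding W_def using sum.subset_diff[OF cnb_subset[OF cU] U] by (simp add: A_def)
  ultimately show ?thesis
    using I(2) sumA max_indep_extend(1)[OF cU indep_singleton] I(1)
    by (intro exI[of _ "{c} \<union> I"]) (simp add: W_def)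
qed

end

subsection \<open>Star partitions\<close>

locale fin_sgraph = sgraph E for E :: "'a \<Rightarrow> 'a \<Rightarrow> bool" +
  fixes V :: "'a set"
  assumes finite_V [simp]: "finite V"
    and adj_in_V: "E u v \<Longrightarrow> u \<in> V"
begin

lemma adj_in_V2: "E u v \<Longrightarrow> v \<in> V"
  using adj_in_V adj_sym by blast

text \<open>A partition into stars is given by the map \<open>p\<close> sending each vertex to the hub of its star;
  \<open>prestar\<close> also allows stars without leaves.\<close>

definition prestar :: "('a \<Rightarrow> 'a) \<Rightarrow> bool" where
  "prestar p \<longleftrightarrow> (\<forall>v\<in>V. p v \<in> V \<and> p (p v) = p v \<and> (p v = v \<or> E v (p v)))"

definition hubs :: "('a \<Rightarrow> 'a) \<Rightarrow> 'a set" where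
  "hubs p = {v \<in> V. p v = v}"

definition leaves :: "('a \<Rightarrow> 'a) \<Rightarrow> 'a \<Rightarrow> 'a set" where
  "leaves p x = {w \<in> V. p w = x} - {x}"

definition star :: "('a \<Rightarrow> 'a) \<Rightarrow> bool" where
  "star p \<longleftrightarrow> prestar p \<and> (\<forall>x\<in>hubs p. leaves p x \<noteq> {})"

lemma finite_hubs [simp]: "finite (hubs p)"
  using finite_V by (simp add: hubs_def)

lemma finite_leaves [simp]: "finite (leaves p x)"
  using finite_V by (simp add: leaves_def)

lemma hubs_subset: "hubs p \<subseteq> V"
  by (auto simp: hubs_def)

lemma hub_fixed: "prestar p \<Longrightarrow> v \<in> V \<Longrightarrow> p v \<in> hubs p"
  by (auto simp: prestar_def hubs_def)

lemma leaves_nonhub: "prestar p \<Longrightarrow> p y \<noteq> y \<Longrightarrow> leaves p y = {}"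
  by (auto simp: prestar_def leaves_def)

lemma leaves_not_hub: "w \<in> leaves p x \<Longrightarrow> w \<notin> hubs p"
  by (auto simp: hubs_def leaves_def)

text \<open>Leaves and neighbouring hubs of a hub are disjoint sets of neighbours. The last
  inequality provides the hypothesis \<open>m u + card (nb U u) \<le> D\<close> of the greedy
  lemmas.\<close>

lemma hub_neighbours:
  assumes "prestar p" "x \<in> hubs p"
  shows "leaves p x \<union> nb (hubs p) x \<subseteq> nb V x"
    and "card (leaves p x \<union> nb (hubs p) x) = card (leaves p x) + card (nb (hubs p) x)"
    and "card (leaves p x) + card (nb (hubs p) x) \<le> card (nb V x)"
proof -
  show sub: "leaves p x \<union> nb (hubs p) x \<subseteq> nb V x"
    using assms adj_sym by (auto simp: leaves_def nb_def hubs_def prestar_def)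
  show eq: "card (leaves p x \<union> nb (hubs p) x) = card (leaves p x) + card (nb (hubs p) x)"
    by (intro card_Un_disjoint) (auto simp: leaves_def nb_def hubs_def)
  show "card (leaves p x) + card (nb (hubs p) x) \<le> card (nb V x)"
    using card_mono[OF finite_nb[OF finite_V] sub] eq by simp
qed

lemma full_hub_neighbours:
  assumes "prestar p" "x \<in> hubs p" "card (nb V x) \<le> card (leaves p x) + card (nb (hubs p) x)"
  shows "nb V x = leaves p x \<union> nb (hubs p) x"
  using hub_neighbours[OF assms(1,2)] assms(3) finite_V by (intro card_seteq[symmetric]) auto

lemma sum_leaves:
  assumes "prestar p"
  shows "card V = card (hubs p) + (\<Sum>x\<in>hubs p. card (leaves p x))"
    and "card (V - hubs p) = (\<Sum>x\<in>hubs p. card (leaves p x))"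
proof -
  have "V - hubs p = (\<Union>x\<in>hubs p. leaves p x)"
    using assms by (auto simp: prestar_def leaves_def hubs_def)
  moreover have "card (\<Union>x\<in>hubs p. leaves p x) = (\<Sum>x\<in>hubs p. card (leaves p x))"
    by (intro card_UN_disjoint) (auto simp: leaves_def)
  ultimately show *: "card (V - hubs p) = (\<Sum>x\<in>hubs p. card (leaves p x))" by simp
  show "card V = card (hubs p) + (\<Sum>x\<in>hubs p. card (leaves p x))"
    using card_Diff_subset[OF finite_hubs hubs_subset, of p] card_mono[OF finite_V hubs_subset, of p] * by simp
qed

text \<open>\<open>I\<close> dominates every hub and all leaves of its own stars. What remains
  undominated consists of leaves of other stars, and extending \<open>I\<close> inside this rest
  adds at most one vertex for each of them.\<close>

lemma max_indep_from_hubs: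
  assumes "prestar p" "max_indep (hubs p) I"
  shows "\<exists>S. max_indep V S \<and>
    card S + (\<Sum>x\<in>I. card (leaves p x)) \<le> card I + card (V - hubs p)"
proof -
  have I: "I \<subseteq> V" "indep I" "I \<subseteq> hubs p" using assms(2) by (auto simp: max_indep_def hubs_def)
  define Y where "Y = V - cnb V I"
  obtain J where J: "max_indep Y J" using max_indep_exists[of Y] finite_V by (auto simp: Y_def)
  have fin: "finite I" "finite J" "finite Y"
    using I J finite_subset[of I V] finite_subset[of J Y] by (simp_all add: max_indep_def Y_def)
  have S: "max_indep V (I \<union> J)" "I \<inter> J = {}"
    using max_indep_extend[OF I(1,2)] J by (auto simp: Y_def)
  have UN: "card (\<Union>x\<in>I. leaves p x) = (\<Sum>x\<in>I. card (leaves p x))"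
    by (intro card_UN_disjoint) (use fin in \<open>auto simp: leaves_def\<close>)
  have sub: "(\<Union>x\<in>I. leaves p x) \<subseteq> V - hubs p"
    using leaves_not_hub by (auto simp: leaves_def)
  have "Y \<inter> hubs p = {}"
  proof -
    have "v \<in> cnb V I" if v: "v \<in> hubs p" for v
    proof (cases "v \<in> I")
      case True then show ?thesis by (simp add: cnb_def)
    next
      case False
      then obtain u where u: "u \<in> I" "E v u" using assms(2) v by (auto simp: max_indep_def)
      then have "v \<in> nb V u" using adj_sym v by (simp add: nb_def hubs_def)
      then show ?thesis using u by (auto simp: cnb_def)
    qed
    then show ?thesis by (auto simp: Y_def)
  qed
  moreover have "(\<Union>x\<in>I. leaves p x) \<subseteq> cnb V I"
    using hub_neighbours(1)[OF assms(1)] I(3) unfolding cnb_def by blast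
  ultimately have "Y \<subseteq> (V - hubs p) - (\<Union>x\<in>I. leaves p x)" by (auto simp: Y_def)
  then have "card Y \<le> card ((V - hubs p) - (\<Union>x\<in>I. leaves p x))"
    using finite_V by (intro card_mono) auto
  also have "\<dots> = card (V - hubs p) - card (\<Union>x\<in>I. leaves p x)"
    using sub fin by (intro card_Diff_subset) auto
  finally have "card Y + card (\<Union>x\<in>I. leaves p x) \<le> card (V - hubs p)"
    using card_mono[OF _ sub] finite_V by auto
  moreover have "card J \<le> card Y" using J fin card_mono[of Y J] by (simp add: max_indep_def)
  moreover have "card (I \<union> J) = card I + card J" using fin S(2) by (intro card_Un_disjoint) auto
  ultimately show ?thesis using S(1) UN by (intro exI[of _ "I \<union> J"]) auto
qed

text \<open>Moves \<open>y\<close> to a star with hub \<open>z\<close>. If \<open>z\<close> was a leaf, it is promoted to a hub, and when it was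
  the only leaf of its old hub, that hub becomes a leaf of \<open>z\<close>.\<close>

definition attach :: "('a \<Rightarrow> 'a) \<Rightarrow> 'a \<Rightarrow> 'a \<Rightarrow> 'a \<Rightarrow> 'a" where
  "attach p y z =
     (if p z = z then p(y := z)
      else if leaves p (p z) = {z} then p(z := z, p z := z, y := z)
      else p(z := z, y := z))"

section \<open>Effect of a move on hubs, leaves and weight\<close>

context
  fixes p y z
  assumes p: "prestar p" and yz: "E y z" "p z \<noteq> p y" and y: "leaves p y = {}"
begin

lemma attach_distinct: "y \<noteq> z" "y \<noteq> p z" "z \<noteq> p y" "y \<in> V" "z \<in> V" "p z \<in> V"
proof -
  show yV: "y \<in> V" and zV: "z \<in> V" using yz adj_in_V adj_in_V2 by auto
  show "y \<noteq> z" using yz adj_irrefl by auto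
  show "y \<noteq> p z" using yz(2) p zV by (auto simp: prestar_def)
  show "z \<noteq> p y" using yz(2) p yV by (auto simp: prestar_def)
  show "p z \<in> V" using p zV by (auto simp: prestar_def)
qed

lemma not_to_y: "w \<in> V \<Longrightarrow> w \<noteq> y \<Longrightarrow> p w \<noteq> y"
  using y by (auto simp: leaves_def)

lemma attach_hub:
  assumes "p z = z"
  shows "prestar (attach p y z)" "hubs (attach p y z) = hubs p - {y}"
    "leaves (attach p y z) z = insert y (leaves p z)"
    "x \<noteq> z \<Longrightarrow> leaves (attach p y z) x = leaves p x - {y}"
proof -
  have att: "attach p y z = p(y := z)" using assms by (simp add: attach_def)
  show "prestar (attach p y z)"
    using p assms attach_distinct yz not_to_y unfolding att by (auto simp: prestar_def)
  show "hubs (attach p y z) = hubs p - {y}"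
    using attach_distinct unfolding att by (auto simp: hubs_def)
  show "leaves (attach p y z) z = insert y (leaves p z)"
    using attach_distinct unfolding att by (auto simp: leaves_def)
  show "leaves (attach p y z) x = leaves p x - {y}" if "x \<noteq> z"
    using attach_distinct that y unfolding att by (auto simp: leaves_def)
qed

lemma attach_leaf:
  assumes "p z \<noteq> z" "leaves p (p z) \<noteq> {z}"
  shows "prestar (attach p y z)" "hubs (attach p y z) = insert z (hubs p - {y})"
    "leaves (attach p y z) z = {y}"
    "x \<noteq> z \<Longrightarrow> leaves (attach p y z) x = leaves p x - {y, z}"
proof -
  have att: "attach p y z = p(z := z, y := z)" using assms by (simp add: attach_def)
  have not_z: "p w \<noteq> z" if "w \<in> V" for w using p assms(1) that by (auto simp: prestar_def)
  show "prestar (attach p y z)"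
    using p attach_distinct yz not_to_y not_z unfolding att by (auto simp: prestar_def)
  show "hubs (attach p y z) = insert z (hubs p - {y})"
    using attach_distinct unfolding att by (auto simp: hubs_def)
  show "leaves (attach p y z) z = {y}"
    using attach_distinct not_z unfolding att by (auto simp: leaves_def)
  show "leaves (attach p y z) x = leaves p x - {y, z}" if "x \<noteq> z"
    using attach_distinct that y unfolding att by (auto simp: leaves_def)
qed

lemma attach_single_leaf:
  assumes "p z \<noteq> z" "leaves p (p z) = {z}"
  shows "prestar (attach p y z)" "hubs (attach p y z) = insert z (hubs p - {y, p z})"
    "leaves (attach p y z) z = {p z, y}"
    "x \<noteq> z \<Longrightarrow> x \<noteq> p z \<Longrightarrow> leaves (attach p y z) x = leaves p x - {y}"
proof -
  have att: "attach p y z = p(z := z, p z := z, y := z)" using assms by (simp add: attach_def)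
  have not_z: "p w \<noteq> z" if "w \<in> V" for w using p assms(1) that by (auto simp: prestar_def)
  have to_pz: "w = z \<or> w = p z" if "w \<in> V" "p w = p z" for w
    using assms(2) that by (auto simp: leaves_def)
  have Epz: "E (p z) z" using p assms(1) attach_distinct(5) adj_sym by (auto simp: prestar_def)
  have ppz: "p (p z) = p z" using p attach_distinct(5) by (auto simp: prestar_def)
  show "prestar (attach p y z)"
    using p attach_distinct yz not_to_y not_z to_pz Epz unfolding att
    by (auto simp: prestar_def)
  show "hubs (attach p y z) = insert z (hubs p - {y, p z})"
    using attach_distinct assms(1) unfolding att by (auto simp: hubs_def)
  show "leaves (attach p y z) z = {p z, y}"
    using attach_distinct assms(1) not_z unfolding att by (auto simp: leaves_def)
  show "leaves (attach p y z) x = leaves p x - {y}" if "x \<noteq> z" "x \<noteq> p z"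
    using attach_distinct that y ppz unfolding att by (auto simp: leaves_def)
qed

lemma attach_prestar: "prestar (attach p y z)"
  using attach_hub(1) attach_leaf(1) attach_single_leaf(1) by blast

text \<open>No star becomes leafless by a move. By assumption the star that \<open>y\<close> leaves
  keeps another leaf or consists of \<open>y\<close> alone. If \<open>z\<close> was the only leaf of
  its hub, that hub stops being a hub. No star loses both \<open>y\<close> and \<open>z\<close>,
  since they belong to different stars.\<close>

lemma attach_empty:
  assumes "p y = y \<or> leaves p (p y) \<noteq> {y}"
    and "x \<in> hubs (attach p y z)" "leaves (attach p y z) x = {}"
  shows "x \<in> hubs p" "leaves p x = {}" "x \<noteq> y"
proof -
  have Ly: "leaves p x \<noteq> {}" if "y \<in> leaves p x" "leaves p x - {y} = {}" for x
    using that by auto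
  have no_y: "leaves p x - {y} = {} \<Longrightarrow> leaves p x = {}" for x
  proof -
    assume *: "leaves p x - {y} = {}"
    show "leaves p x = {}"
    proof (rule ccontr)
      assume "leaves p x \<noteq> {}"
      then have "leaves p x = {y}" using * by auto
      then have "p y = x" "x \<noteq> y" by (auto simp: leaves_def)
      then show False using assms(1) \<open>leaves p x = {y}\<close> by auto
    qed
  qed
  have "x \<in> hubs p \<and> leaves p x = {} \<and> x \<noteq> y"
  proof (cases "p z = z")
    case True
    then show ?thesis using assms(2,3) attach_hub[OF True] no_y by (cases "x = z") auto
  next
    case nz: False
    show ?thesis
    proof (cases "leaves p (p z) = {z}")
      case True
      then show ?thesis using assms(2,3) attach_single_leaf[OF nz True] no_y by (cases "x = z") auto
    next
      case False
      have xz: "x \<noteq> z" using attach_leaf(3)[OF nz False] assms(3) by auto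
      then have xh: "x \<in> hubs p" "x \<noteq> y" and e: "leaves p x - {y, z} = {}"
        using assms(2,3) attach_leaf(2,4)[OF nz False] by auto
      have "z \<notin> leaves p x"
      proof
        assume z: "z \<in> leaves p x"
        then have pz: "p z = x" by (auto simp: leaves_def)
        then have "y \<notin> leaves p x" using yz(2) by (auto simp: leaves_def)
        then have "leaves p x = {z}" using e z by auto
        then show False using False pz by simp
      qed
      then have "leaves p x = {}" using e by (intro no_y) auto
      then show ?thesis using xh by blast
    qed
  qed
  then show "x \<in> hubs p" "leaves p x = {}" "x \<noteq> y" by auto
qed

lemma attach_star:
  assumes "star p" "leaves p (p y) \<noteq> {y}"
  shows "star (attach p y z)"
  unfolding star_def
proof (intro conjI ballI notI attach_prestar)
  fix x assume "x \<in> hubs (attach p y z)" "leaves (attach p y z) x = {}"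
  then show False using attach_empty(1,2)[of x] assms unfolding star_def by blast
qed

text \<open>At most three vertices get the new hub \<open>z\<close>, whence the base \<open>4\<close>.\<close>

lemma attach_weight:
  fixes d :: "'a \<Rightarrow> nat"
  assumes "d z < d (p y)"
  shows "(\<Sum>v\<in>V. (4::nat) ^ d (attach p y z v)) < (\<Sum>v\<in>V. 4 ^ d (p v))"
proof -
  let ?w = "\<lambda>v. (4::nat) ^ d v" and ?p' = "attach p y z"
  have p'y: "?p' y = z" by (simp add: attach_def)
  have "?w (?p' v) \<le> ?w (p v) + (if v = z then ?w z else 0) + (if v = p z then ?w z else 0)"
    if "v \<noteq> y" for v
    using that by (auto simp: attach_def)
  then have "(\<Sum>v\<in>V - {y}. ?w (?p' v))
      \<le> (\<Sum>v\<in>V - {y}. ?w (p v) + (if v = z then ?w z else 0) + (if v = p z then ?w z else 0))"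
    by (intro sum_mono) auto
  also have "\<dots> = (\<Sum>v\<in>V - {y}. ?w (p v)) + 2 * ?w z"
    using finite_V attach_distinct by (simp add: sum.distrib sum.delta)
  finally have 1: "(\<Sum>v\<in>V - {y}. ?w (?p' v)) \<le> (\<Sum>v\<in>V - {y}. ?w (p v)) + 2 * ?w z" .
  have "4 * ?w z = 4 ^ Suc (d z)" by simp
  also have "\<dots> \<le> ?w (p y)" using assms by (intro power_increasing) auto
  finally have 2: "4 * ?w z \<le> ?w (p y)" .
  have "?w z > 0" by simp
  then have "?w z + (\<Sum>v\<in>V - {y}. ?w (?p' v)) < ?w (p y) + (\<Sum>v\<in>V - {y}. ?w (p v))"
    using 1 2 by linarith
  then show ?thesis
    using sum.remove[OF finite_V attach_distinct(4), of "\<lambda>v. ?w (?p' v)"]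
      sum.remove[OF finite_V attach_distinct(4), of "\<lambda>v. ?w (p v)"] p'y by simp
qed

end

text \<open>The identity is a \<open>prestar\<close>, so there is one with the fewest leafless hubs.
  Attaching a leafless hub to any neighbour removes it from the count and by
  \<open>attach_empty\<close> adds no other, so the minimum is 0.\<close>

lemma star_exists:
  assumes "\<And>v. v \<in> V \<Longrightarrow> \<exists>w. E v w"
  shows "\<exists>p. star p"
proof -
  define e where "e p = {x \<in> hubs p. leaves p x = {}}" for p
  have "prestar id" by (simp add: prestar_def)
  then obtain p where p: "prestar p" and min: "\<And>q. prestar q \<Longrightarrow> card (e p) \<le> card (e q)"
    using ex_has_least_nat[of prestar id "\<lambda>p. card (e p)"] by auto
  have "e p = {}"
  proof (rule ccontr)
    assume "e p \<noteq> {}"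
    then obtain y where y: "y \<in> hubs p" "leaves p y = {}" by (auto simp: e_def)
    then obtain z where z: "E y z" using assms by (auto simp: hubs_def)
    have zV: "z \<in> V" and yz: "y \<noteq> z" and py: "p y = y"
      using z adj_in_V2 adj_irrefl y by (auto simp: hubs_def)
    then have ne: "p z \<noteq> p y" using y(2) by (auto simp: leaves_def)
    have "e (attach p y z) \<subseteq> e p - {y}"
      using attach_empty[OF p z ne y(2)] py unfolding e_def by blast
    then have "card (e (attach p y z)) < card (e p)"
      using y by (intro psubset_card_mono) (auto simp: e_def)
    then show False using min[OF attach_prestar[OF p z ne y(2)]] by simp
  qed
  then show ?thesis using p by (auto simp: star_def e_def)
qed

text \<open>Let \<open>y\<close> be closest to \<open>r\<close> among all vertices of the stars of
  \<open>Q\<close>. A neighbour \<open>z\<close> closer to \<open>r\<close> lies outside these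
  stars. Hubs in \<open>Q\<close> have no such neighbour, so \<open>y\<close> is a leaf, and its hub
  is no closer to \<open>r\<close> than \<open>y\<close> itself.\<close>

lemma exists_move_towards:
  fixes d :: "'a \<Rightarrow> nat"
  assumes p: "prestar p" and Q: "Q \<subseteq> hubs p" "Q \<noteq> {}"
    and full: "\<And>x. x \<in> Q \<Longrightarrow> nb V x \<subseteq> {w \<in> V. p w \<in> Q}"
    and d: "\<And>v. v \<in> V \<Longrightarrow> v \<noteq> r \<Longrightarrow> \<exists>z. E v z \<and> d z < d v"
    and r: "p r \<notin> Q"
  shows "\<exists>y z. E y z \<and> p y \<in> Q \<and> p y \<noteq> y \<and> p z \<notin> Q \<and> d z < d (p y)"
proof -
  define F where "F = {w \<in> V. p w \<in> Q}"
  obtain q where q: "q \<in> Q" using Q(2) by blast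
  then have "q \<in> F" using Q(1) by (auto simp: F_def hubs_def)
  then obtain y where y: "y \<in> F" and min: "\<And>w. w \<in> F \<Longrightarrow> d y \<le> d w"
    using ex_has_least_nat[of "\<lambda>w. w \<in> F" q d] by auto
  have "y \<noteq> r" using y r by (auto simp: F_def)
  then obtain z where z: "E y z" "d z < d y" using d y by (auto simp: F_def)
  then have zF: "z \<notin> F" using min by fastforce
  then have pz: "p z \<notin> Q" using z(1) adj_in_V2 by (auto simp: F_def)
  have "y \<notin> Q" using full[of y] zF z(1) adj_in_V2[OF z(1)] by (auto simp: F_def nb_def)
  then have "p y \<noteq> y" using y by (auto simp: F_def)
  moreover have "p y \<in> F" using y p by (auto simp: F_def prestar_def)
  ultimately show ?thesis using z pz y min by (intro exI[of _ y] exI[of _ z]) (force simp: F_def)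
qed

text \<open>In a star partition of least weight, a set \<open>Q\<close> that misses the hub of
  \<open>r\<close> would admit the move of \<open>exists_move_towards\<close>. The second leaf of
  each hub in \<open>Q\<close> keeps the result a star partition, and \<open>attach_weight\<close>
  contradicts minimality.\<close>

lemma exists_rooted_star:
  fixes d :: "'a \<Rightarrow> nat"
  assumes star: "star p0"
    and d: "\<And>v. v \<in> V \<Longrightarrow> v \<noteq> r \<Longrightarrow> \<exists>z. E v z \<and> d z < d v"
  shows "\<exists>p. star p \<and> (\<forall>Q. Q \<noteq> {} \<longrightarrow> Q \<subseteq> hubs p \<longrightarrow>
     (\<forall>x\<in>Q. nb V x \<subseteq> {w \<in> V. p w \<in> Q} \<and> 2 \<le> card (leaves p x)) \<longrightarrow> p r \<in> Q)"
proof -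
  obtain p where p: "star p"
    and min: "\<And>q. star q \<Longrightarrow> (\<Sum>v\<in>V. (4::nat) ^ d (p v)) \<le> (\<Sum>v\<in>V. 4 ^ d (q v))"
    using ex_has_least_nat[of star p0 "\<lambda>p. \<Sum>v\<in>V. (4::nat) ^ d (p v)"] star by auto
  have pre: "prestar p" using p by (simp add: star_def)
  have "p r \<in> Q" if Q: "Q \<noteq> {}" "Q \<subseteq> hubs p" 
    and full: "\<And>x. x \<in> Q \<Longrightarrow> nb V x \<subseteq> {w \<in> V. p w \<in> Q} \<and> 2 \<le> card (leaves p x)" for Q
  proof (rule ccontr)
    assume "p r \<notin> Q"
    then obtain y z where yz: "E y z" "p y \<in> Q" "p y \<noteq> y" "p z \<notin> Q" "d z < d (p y)"
      using exists_move_towards[OF pre Q(2,1) _ d] full by blast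
    have ne: "p z \<noteq> p y" using yz by auto
    have ly: "leaves p y = {}" using leaves_nonhub[OF pre yz(3)] .
    have "leaves p (p y) \<noteq> {y}" using full[OF yz(2)] by auto
    then have "star (attach p y z)" using attach_star[OF pre yz(1) ne ly p] by blast
    then show False using min[of "attach p y z"] attach_weight[OF pre yz(1) ne ly, of d] yz(5) by simp
  qed
  then show ?thesis using p by (intro exI[of _ p] conjI allI impI) auto
qed

text \<open>Leaves and neighbouring hubs already amount to \<open>D\<close>, so a tight hub has no
  other neighbours. This makes \<open>exists_rooted_star\<close> applicable to tight sets.\<close>

lemma tight_set_hubs_full:
  assumes "prestar p" "\<And>v. v \<in> V \<Longrightarrow> card (nb V v) \<le> D" "4 \<le> D"
    and Q: "tight_set (\<lambda>x. card (leaves p x)) D (hubs p) Q" and x: "x \<in> Q"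
  shows "nb V x \<subseteq> {w \<in> V. p w \<in> Q} \<and> 2 \<le> card (leaves p x)"
proof -
  obtain M where M: "M\<^sup>2 + D\<^sup>2 div 4 = D * M" "card (leaves p x) = M" "M + card (nb (hubs p) x) = D"
    and Q': "Q \<subseteq> hubs p" "nb (hubs p) x \<subseteq> Q"
    using Q x unfolding tight_set_def closed_in_def by blast
  have xh: "x \<in> hubs p" using Q' x by auto
  have "card (nb V x) \<le> card (leaves p x) + card (nb (hubs p) x)"
    using assms(2)[of x] M xh by (auto simp: hubs_def)
  then have "nb V x = leaves p x \<union> nb (hubs p) x" by (rule full_hub_neighbours[OF assms(1) xh])
  then have "nb V x \<subseteq> {w \<in> V. p w \<in> Q}"
    using Q' x by (auto simp: leaves_def nb_def hubs_def)
  then show ?thesis using tight_value_ge(1)[OF assms(3) M(1)] M(2) by simp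
qed

text \<open>With \<open>L\<close> leaves in total and \<open>W\<close> of them in the stars of
  \<open>I\<close>, the hypothesis reads
  \<open>a * L - b * card (hubs p) \<le> (a + b) * (W - card I) + c\<close>, and \<open>S\<close>
  has at most \<open>L - (W - card I)\<close> vertices. Eliminating \<open>W - card I\<close> leaves
  \<open>b\<close> times the number of leaves and hubs, plus \<open>c\<close>.\<close>

lemma max_indep_of_weighted_bound:
  fixes a b c :: int
  assumes p: "prestar p" and ab: "0 \<le> a + b" and I: "max_indep (hubs p) I"
    and le: "(\<Sum>u\<in>hubs p. a * int (card (leaves p u)) - b)
      \<le> (\<Sum>h\<in>I. (a + b) * (int (card (leaves p h)) - 1)) + c"
  shows "\<exists>S. max_indep V S \<and> (a + b) * int (card S) \<le> b * int (card V) + c"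
proof -
  let ?m = "\<lambda>x. card (leaves p x)"
  obtain S where S: "max_indep V S" "card S + (\<Sum>x\<in>I. ?m x) \<le> card I + card (V - hubs p)"
    using max_indep_from_hubs[OF p I] by blast
  define L where "L = int (\<Sum>x\<in>hubs p. ?m x)"
  define W where "W = int (\<Sum>x\<in>I. ?m x)"
  have "(\<Sum>u\<in>hubs p. a * int (?m u) - b) = a * L - int (card (hubs p)) * b"
    by (simp add: L_def sum_subtractf sum_distrib_left)
  moreover have "(\<Sum>h\<in>I. (a + b) * (int (?m h) - 1)) = (a + b) * (W - int (card I))"
    by (simp add: W_def sum_subtractf flip: sum_distrib_left)
  ultimately have 1: "a * L - int (card (hubs p)) * b \<le> (a + b) * (W - int (card I)) + c"
    using le by simp
  have "int (card S) \<le> L - (W - int (card I))"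
    using S(2) sum_leaves(2)[OF p] unfolding L_def W_def by linarith
  then have "(a + b) * int (card S) \<le> (a + b) * (L - (W - int (card I)))"
    using ab by (intro mult_left_mono)
  also have "\<dots> = (a + b) * L - (a + b) * (W - int (card I))" by (simp add: right_diff_distrib)
  also have "\<dots> \<le> (a + b) * L - a * L + int (card (hubs p)) * b + c" using 1 by linarith
  also have "\<dots> = b * int (card V) + c"
    using sum_leaves(1)[OF p] unfolding L_def by (simp add: algebra_simps)
  finally show ?thesis using S(1) by blast
qed

section \<open>The bound for maximum degree other than 5\<close>

lemma star_leaves_pos: "star p \<Longrightarrow> u \<in> hubs p \<Longrightarrow> 1 \<le> card (leaves p u)"
  by (simp add: star_def Suc_le_eq card_gt_0_iff)

lemma max_indep_bound_not_5:
  fixes D :: nat and d :: "'a \<Rightarrow> nat"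
  defines "f \<equiv> int (D\<^sup>2 div 4)"
  assumes D: "4 \<le> D" "D \<noteq> 5"
    and deg: "\<And>v. v \<in> V \<Longrightarrow> card (nb V v) \<le> D"
    and iso: "\<And>v. v \<in> V \<Longrightarrow> \<exists>w. E v w"
    and d: "\<And>v. v \<in> V \<Longrightarrow> v \<noteq> r \<Longrightarrow> \<exists>z. E v z \<and> d z < d v"
  shows "\<exists>S. max_indep V S \<and> (f + int D) * int (card S) \<le> f * int (card V) + int D"
proof -
  obtain p0 where "star p0" using star_exists iso by blast
  then obtain p where p: "star p"
    and rooted: "\<And>Q. Q \<noteq> {} \<Longrightarrow> Q \<subseteq> hubs p \<Longrightarrow>
     (\<forall>x\<in>Q. nb V x \<subseteq> {w \<in> V. p w \<in> Q} \<and> 2 \<le> card (leaves p x)) \<Longrightarrow> p r \<in> Q"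
    using exists_rooted_star[OF _ d] by blast
  have pre: "prestar p" using p by (simp add: star_def)
  let ?m = "\<lambda>x. card (leaves p x)"
  \<comment> \<open>The hub of the root serves as the common vertex \<open>c\<close> of all tight
    sets in \<open>weighted_greedy\<close>.\<close>
  have "p r \<in> Q" if "tight_set ?m D (hubs p) Q" for Q
    using rooted[of Q] tight_set_hubs_full[OF pre deg D(1) that] that
    unfolding tight_set_def closed_in_def by blast
  moreover have "1 \<le> ?m u" if "u \<in> hubs p" for u
    using star_leaves_pos[OF p that] .
  moreover have "?m u + card (nb (hubs p) u) \<le> D" if "u \<in> hubs p" for u
    using hub_neighbours(3)[OF pre that] deg[of u] that by (auto simp: hubs_def)
  ultimately have "\<exists>I. max_indep (hubs p) I \<and>
    (\<Sum>u\<in>hubs p. int D * int (?m u) - f) \<le> (\<Sum>h\<in>I. (f + int D) * (int (?m h) - 1)) + int D"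
    unfolding f_def by (intro weighted_greedy[OF finite_hubs D])
  then obtain I where I: "max_indep (hubs p) I"
    "(\<Sum>u\<in>hubs p. int D * int (?m u) - f) \<le> (\<Sum>h\<in>I. (f + int D) * (int (?m h) - 1)) + int D" by blast
  have "\<exists>S. max_indep V S \<and> (int D + f) * int (card S) \<le> f * int (card V) + int D"
    using I(2) by (intro max_indep_of_weighted_bound[OF pre _ I(1)]) (auto simp: f_def add.commute)
  then show ?thesis by (simp add: add.commute)
qed

end

subsection \<open>The weighted greedy choice for degree five\<close>

context sgraph begin

text \<open>Choosing a vertex of degree at most 2 removes at most three vertices. The hypothesis
  \<open>low\<close> survives: a closed set of minimum degree 3 in the rest has lost no neighbours,
  because degrees never exceed 3, and so was closed before.\<close>

lemma third_max_indep:
  assumes U: "finite U" "\<And>u. u \<in> U \<Longrightarrow> card (nb U u) \<le> 3"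
    and low: "\<And>R. R \<noteq> {} \<Longrightarrow> closed_in U R \<Longrightarrow> \<exists>u\<in>R. card (nb U u) \<le> 2"
  shows "\<exists>I. max_indep U I \<and> card U \<le> 3 * card I"
proof -
  let ?P = "\<lambda>W. \<forall>R. R \<noteq> {} \<longrightarrow> closed_in W R \<longrightarrow> (\<exists>u\<in>R. card (nb W u) \<le> 2)"
  have "\<exists>I. max_indep U I \<and> (\<Sum>u\<in>U. 1 :: int) \<le> (\<Sum>u\<in>I. 3)"
  proof (rule greedy_max_indep[where P = ?P, OF U(1)])
    show "?P U" using low by blast
  next
    fix W assume W: "W \<subseteq> U" "W \<noteq> {}" and PW: "?P W"
    have finW: "finite W" using W(1) U(1) by (rule finite_subset)
    have "closed_in W W" by (auto simp: closed_in_def nb_def)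
    then obtain h where h: "h \<in> W" "card (nb W h) \<le> 2" using PW W(2) by blast
    have "?P (W - cnb W {h})"
    proof (intro allI impI)
      fix R assume R: "R \<noteq> {}" "closed_in (W - cnb W {h}) R"
      show "\<exists>u\<in>R. card (nb (W - cnb W {h}) u) \<le> 2"
      proof (rule ccontr)
        assume "\<not> ?thesis"
        then have big: "3 \<le> card (nb (W - cnb W {h}) u)" if "u \<in> R" for u using that by force
        have eq: "nb (W - cnb W {h}) u = nb W u" if "u \<in> R" for u
        proof (rule card_seteq)
          have "u \<in> U" using that R(2) W(1) by (auto simp: closed_in_def)
          then have "card (nb W u) \<le> 3"
            using U(2)[of u] card_mono[OF finite_nb[OF U(1)] nb_mono[OF W(1)], of u] by linarith
          then show "card (nb W u) \<le> card (nb (W - cnb W {h}) u)" using big[OF that] by simp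
        qed (use finW in \<open>auto simp: nb_def\<close>)
        then have "closed_in W R" using R(2) by (auto simp: closed_in_def)
        then obtain u where "u \<in> R" "card (nb W u) \<le> 2" using PW R(1) by blast
        then show False using big[of u] eq[of u] by simp
      qed
    qed
    then show "\<exists>J. J \<noteq> {} \<and> J \<subseteq> W \<and> indep J \<and> (\<Sum>u\<in>cnb W J. 1 :: int) \<le> (\<Sum>u\<in>J. 3) \<and> ?P (W - cnb W J)"
      using h finW by (intro exI[of _ "{h}"]) simp
  qed
  then obtain I where "max_indep U I" "int (card U) \<le> 3 * int (card I)" by (auto simp: mult.commute)
  then show ?thesis by (intro exI[of _ I]) auto
qed

text \<open>Connectedness of the graph induced on \<open>S\<close>, expressed through closed sets so
  that it combines directly with \<open>closed_in\<close>.\<close>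

definition linked :: "'a set \<Rightarrow> bool" where
  "linked S \<longleftrightarrow> (\<forall>W. W \<noteq> {} \<longrightarrow> closed_in S W \<longrightarrow> W = S)"

lemma linkedD: "linked S \<Longrightarrow> W \<noteq> {} \<Longrightarrow> closed_in S W \<Longrightarrow> W = S"
  by (simp add: linked_def)

lemma linked_extend:
  assumes S: "linked S" and s: "s \<in> S" "E s u"
  shows "linked (S \<union> insert u (nb C u))"
  unfolding linked_def
proof (intro allI impI)
  let ?S = "S \<union> insert u (nb C u)"
  fix W assume W: "W \<noteq> {}" "closed_in ?S W"
  have step: "y \<in> W" if "x \<in> W" "y \<in> ?S" "E x y" for x y
    using W(2) that by (auto simp: closed_in_def nb_def)
  have Wsub: "W \<subseteq> ?S" using W(2) by (simp add: closed_in_def)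
  have SW: "S \<subseteq> W"
  proof (cases "W \<inter> S = {}")
    case False
    have "closed_in S (W \<inter> S)" using step by (auto simp: closed_in_def nb_def)
    from linkedD[OF S False this] show ?thesis by blast
  next
    case True
    obtain x where x: "x \<in> W" using W(1) by blast
    then have "x \<in> insert u (nb C u)" using True Wsub by blast
    then have "x = u \<or> E x u" by (auto simp: nb_def adj_commute)
    then have "u \<in> W" using step[OF x, of u] x by auto
    then have "s \<in> W" using step[of u s] s(1) adj_sym[OF s(2)] by blast
    then show ?thesis using True s by blast
  qed
  then have u: "u \<in> W" using step[of s u] s by blast
  have "nb C u \<subseteq> W" using step[OF u] by (auto simp: nb_def)
  then show "W = ?S" using SW u Wsub by blast
qed

lemma linked_singleton_nb: "linked (insert h (nb C h))"
proof -
  have "y \<in> W" if W: "W \<noteq> {}" "closed_in (insert h (nb C h)) W" and y: "y \<in> insert h (nb C h)" for W y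
  proof -
    have step: "v \<in> W" if "x \<in> W" "v \<in> insert h (nb C h)" "E x v" for x v
      using W(2) that by (auto simp: closed_in_def nb_def)
    obtain x where x: "x \<in> W" using W(1) by blast
    then have "x = h \<or> E x h" using W(2) by (auto simp: closed_in_def nb_def adj_commute)
    then have h: "h \<in> W" using step[of x h] x by blast
    show ?thesis using y step[OF h] h by (auto simp: nb_def)
  qed
  then show ?thesis unfolding linked_def by (auto simp: closed_in_def)
qed

section \<open>Cubic graphs without complete subgraphs on four vertices\<close>

lemma card_3_obtain:
  assumes "card A = 3" "x \<in> A" "y \<in> A" "x \<noteq> y"
  obtains z where "A = {x, y, z}" "z \<noteq> x" "z \<noteq> y"
proof -
  have "card (A - {x, y}) = 1" using assms by (simp add: card_Diff_subset)
  then obtain z where "A - {x, y} = {z}" by (auto simp: card_Suc_eq)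
  then show ?thesis using that[of z] assms by auto
qed

text \<open>A maximal linked set of the form \<open>S = cnb C J\<close> with \<open>card S \<le> 3 * card J + 1\<close> misses only
  a triangle. An edge added between the outer neighbours of two of its corners prevents a large
  independent subset of \<open>S\<close> from blocking both corners.\<close>

lemma cubic_linked_sparse_nb:
  assumes C: "finite C" "C \<noteq> {}" "linked C"
    and deg: "\<And>u. u \<in> C \<Longrightarrow> card (nb C u) = 3"
    and no_K4: "\<And>u. u \<in> C \<Longrightarrow> \<exists>v\<in>nb C u. \<exists>w\<in>nb C u. v \<noteq> w \<and> \<not> E v w"
  shows "\<exists>J. J \<noteq> {} \<and> J \<subseteq> C \<and> indep J \<and> card (cnb C J) \<le> 3 * card J"
proof (rule ccontr)
  assume "\<not> ?thesis"
  then have big: "3 * card J < card (cnb C J)" if "J \<noteq> {}" "J \<subseteq> C" "indep J" for J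
    using that by force
  define good where "good J \<longleftrightarrow> J \<noteq> {} \<and> J \<subseteq> C \<and> indep J \<and> linked (cnb C J) \<and>
    card (cnb C J) \<le> 3 * card J + 1 \<and> cnb C J \<noteq> C" for J
  obtain h where h: "h \<in> C" using C(2) by blast
  have "good {h}"
  proof -
    \<comment> \<open>Otherwise \<open>C\<close> has only four vertices, and a vertex with a
      non-neighbour among them has degree at most 2.\<close>
    have "insert h (nb C h) \<noteq> C"
    proof
      assume eq: "insert h (nb C h) = C"
      obtain v w where vw: "v \<in> nb C h" "w \<in> nb C h" "v \<noteq> w" "\<not> E v w" using no_K4[OF h] by blast
      have vC: "v \<in> C" using vw(1) nb_subset by blast
      have "card C = 4" using deg[OF h] C(1) by (subst eq[symmetric]) simp
      have "nb C v \<subseteq> C - {v, w}" using vw(4) adj_irrefl by (auto simp: nb_def)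
      then have "card (nb C v) \<le> card (C - {v, w})" using C(1) by (intro card_mono) auto
      also have "\<dots> = 2" using vw vC \<open>card C = 4\<close> nb_subset[of C h] C(1) by (subst card_Diff_subset) auto
      finally show False using deg[OF vC] by simp
    qed
    then show ?thesis using h deg[OF h] C(1) linked_singleton_nb by (simp add: good_def)
  qed
  moreover have "\<forall>J'. good J' \<longrightarrow> card (cnb C J') < card C + 1"
    using card_mono[OF C(1) cnb_subset] by (simp add: good_def less_Suc_eq_le)
  ultimately have "\<exists>J. good J \<and> (\<forall>J'. good J' \<longrightarrow> card (cnb C J') \<le> card (cnb C J))"
    by (rule ex_has_greatest_nat)
  then obtain J where J: "good J" and max: "\<And>J'. good J' \<Longrightarrow> card (cnb C J') \<le> card (cnb C J)" by blast
  define S where "S = cnb C J"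
  have J': "J \<noteq> {}" "J \<subseteq> C" "indep J" "linked S" "card S \<le> 3 * card J + 1" "S \<noteq> C"
    using J by (auto simp: good_def S_def)
  have SC: "S \<subseteq> C" unfolding S_def using J'(2) by (rule cnb_subset)
  have finJ: "finite J" and finS: "finite S" using finite_subset[OF J'(2) C(1)] finite_subset[OF SC C(1)] by auto
  have "S \<noteq> {}" using J'(1) by (auto simp: S_def cnb_def)
  then have "\<not> closed_in C S" using linkedD[OF C(3)] J'(6) by blast
  then obtain s u where su: "s \<in> S" "u \<in> C" "E s u" "u \<notin> S"
    using SC by (auto simp: closed_in_def nb_def)
  have add: "indep (insert x J)" "cnb C (insert x J) = S \<union> insert x (nb C x)" "card (insert x J) = card J + 1"
    if x: "x \<in> C" "x \<notin> S" for x
  proof -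
    have "\<not> E y x" if "y \<in> J" for y
      using x that by (auto simp: S_def cnb_def nb_def)
    then show "indep (insert x J)" using J'(3) adj_irrefl by (auto simp: indep_def adj_commute)
    show "cnb C (insert x J) = S \<union> insert x (nb C x)" by (auto simp: cnb_def S_def)
    have "x \<notin> J" using x(2) by (auto simp: S_def cnb_def)
    then show "card (insert x J) = card J + 1" using finJ by simp
  qed
  define T where "T = insert u (nb C u) - S"
  \<comment> \<open>The neighbour \<open>s\<close> of \<open>u\<close> is already in
    \<open>S\<close>, so \<open>u\<close> brings in at most three new vertices, just what one
    further chosen vertex allows.\<close>
  have "T \<subseteq> insert u (nb C u) - {s}" using su(1) by (auto simp: T_def)
  moreover have "card (insert u (nb C u) - {s}) = 3"
  proof -
    have "s \<in> nb C u" using su SC by (auto simp: nb_def adj_commute)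
    then show ?thesis using deg[OF su(2)] C(1) by simp
  qed
  ultimately have T3: "card T \<le> 3" using C(1) card_mono[of "insert u (nb C u) - {s}" T] by simp
  have ST: "cnb C (insert u J) = S \<union> T" "S \<inter> T = {}" using add(2)[OF su(2,4)] by (auto simp: T_def)
  have finT: "finite T" using C(1) by (simp add: T_def)
  have cardST: "card (cnb C (insert u J)) = card S + card T"
    unfolding ST using finS finT ST(2) by (rule card_Un_disjoint)
  \<comment> \<open>Otherwise \<open>insert u J\<close> would be good with a strictly larger closed
    neighbourhood.\<close>
  have "cnb C (insert u J) = C"
  proof (rule ccontr)
    assume "cnb C (insert u J) \<noteq> C"
    moreover have "linked (cnb C (insert u J))"
      using linked_extend[OF J'(4) su(1,3)] add(2)[OF su(2,4)] by simp
    ultimately have "good (insert u J)"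
      using add[OF su(2,4)] J' su(2) cardST T3 by (auto simp: good_def)
    then have "card S + card T \<le> card S" using max[of "insert u J"] cardST by (simp add: S_def)
    then show False using su(4) finT by (auto simp: T_def)
  qed
  then have CST: "C = S \<union> T" using ST by simp
  have "card T = 3"
    using big[of "insert u J"] add[OF su(2,4)] J'(2,5) su(2) cardST T3 by simp
  moreover have "u \<in> T" using su(4) by (simp add: T_def)
  ultimately obtain v w where T: "T = {u, v, w}" "v \<noteq> u" "w \<noteq> u" "v \<noteq> w"
  proof -
    have "card (T - {u}) = 2" using \<open>card T = 3\<close> \<open>u \<in> T\<close> by simp
    then obtain v w where "T - {u} = {v, w}" "v \<noteq> w" by (auto simp: card_2_iff)
    then show ?thesis using that[of v w] \<open>u \<in> T\<close> by auto
  qed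
  have nbu: "v \<in> nb C u" "w \<in> nb C u" using T by (auto simp: T_def)
  have notS: "u \<notin> S" "v \<notin> S" "w \<notin> S" and inC: "u \<in> C" "v \<in> C" "w \<in> C" using T ST(2) CST by auto
  \<comment> \<open>If \<open>v\<close> and \<open>w\<close> were not adjacent, choosing
    \<open>v\<close> would add only \<open>v\<close> and \<open>u\<close> to \<open>S\<close>, and
    two new vertices contradict \<open>big\<close>.\<close>
  have "E v w"
  proof (rule ccontr)
    assume nE: "\<not> E v w"
    have "cnb C (insert v J) \<subseteq> S \<union> {v, u}"
      using add(2)[OF inC(2) notS(2)] CST T nE by (auto simp: nb_def)
    then have "card (cnb C (insert v J)) \<le> card (S \<union> {v, u})" using finS by (intro card_mono) auto
    also have "\<dots> \<le> card S + card {v, u}" by (rule card_Un_le)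
    finally show False
      using big[of "insert v J"] add[OF inC(2) notS(2)] J'(2,5) inC T(2) by simp
  qed
  then have tri: "E u v" "E u w" "E v w" "E v u" "E w u" "E w v"
    using nbu by (auto simp: nb_def adj_commute)
  obtain u' where u': "nb C u = {v, w, u'}" "u' \<noteq> v" "u' \<noteq> w"
    using card_3_obtain[OF deg[OF inC(1)], of v w] nbu T(4) by blast
  obtain v' where v': "nb C v = {u, w, v'}" "v' \<noteq> u" "v' \<noteq> w"
    using card_3_obtain[OF deg[OF inC(2)], of u w] tri inC T(3) by (auto simp: nb_def)
  obtain w' where w': "nb C w = {u, v, w'}" "w' \<noteq> u" "w' \<noteq> v"
    using card_3_obtain[OF deg[OF inC(3)], of u v] tri inC T(2) by (auto simp: nb_def)
  have out: "u' \<notin> T" "v' \<notin> T" "w' \<notin> T"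
    using u' v' w' T nb_notin[of u C] nb_notin[of v C] nb_notin[of w C] by auto
  have outC: "u' \<in> C" "v' \<in> C" "w' \<in> C"
    using u'(1) v'(1) w'(1) nb_subset[of C u] nb_subset[of C v] nb_subset[of C w] by auto
  then have outS: "u' \<in> S" "v' \<in> S" "w' \<in> S" using out CST by auto
  have inner: "u \<in> nb C u'" "v \<in> nb C v'" "w \<in> nb C w'"
    using u'(1) v'(1) w'(1) inC outC by (auto simp: nb_def adj_commute)
  \<comment> \<open>A common outer neighbour \<open>a'\<close> of two corners either is adjacent to
    the third corner too, which gives a complete graph on four vertices, or forms with the third
    corner an independent pair whose closed neighbourhood has at most six vertices.\<close>
  have diff: "a' \<noteq> b'"
    if abc: "nb C a = {b, c, a'}" "nb C b = {a, c, b'}" "nb C c = {a, b, c'}" "{a, b, c} = T" "a \<noteq> b" "a \<noteq> c" "b \<noteq> c"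
      and a': "a' \<notin> T" "a' \<in> C" for a b c a' b' c'
  proof
    assume eq: "a' = b'"
    have inC': "a \<in> C" "b \<in> C" "c \<in> C" using abc(4) CST by auto
    have ab: "a \<in> nb C a'" "b \<in> nb C a'"
      using abc(1,2) eq inC' a'(2) by (auto simp: nb_def adj_commute)
    show False
    proof (cases "E c a'")
      case True
      then have "c \<in> nb C a'" using inC' by (simp add: nb_def adj_commute)
      then have "{a, b, c} \<subseteq> nb C a'" using ab by simp
      then have "nb C a' = {a, b, c}"
        using deg[OF a'(2)] abc(5-7) C(1) by (intro card_seteq[symmetric]) auto
      moreover have "E x y" if "x \<in> {a, b, c}" "y \<in> {a, b, c}" "x \<noteq> y" for x y
        using that tri abc(4) T(1) by auto
      ultimately show False using no_K4[OF a'(2)] by blast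
    next
      case False
      obtain x where x: "nb C a' = {a, b, x}"
        using card_3_obtain[OF deg[OF a'(2)] ab abc(5)] by blast
      have "c \<noteq> a'" using a'(1) abc(4) by auto
      have "indep {c, a'}" using False adj_irrefl by (auto simp: indep_def adj_commute)
      moreover have "cnb C {c, a'} \<subseteq> set [c, a', a, b, c', x]" using abc(3) x by (auto simp: cnb_def)
      then have "card (cnb C {c, a'}) \<le> 6"
        using card_mono[of "set [c, a', a, b, c', x]" "cnb C {c, a'}"] card_length[of "[c, a', a, b, c', x]"] by simp
      ultimately show False using big[of "{c, a'}"] \<open>c \<noteq> a'\<close> a'(2) inC' by simp
    qed
  qed
  have "u' \<noteq> v'" by (rule diff[of u v w u' v' w']) (use u' v' w' T out outC in auto)
  have "u' \<noteq> w'" by (rule diff[of u w v u' w' v']) (use u' v' w' T out outC in auto)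
  have "v' \<noteq> w'" by (rule diff[of v w u v' w' u']) (use u' v' w' T out outC in auto)
  \<comment> \<open>\<open>u'\<close> and \<open>w'\<close> each have a neighbour outside
    \<open>S\<close>, so the new edge keeps all degrees within \<open>S\<close> at most 3. It does
    not touch \<open>v'\<close>, whose degree within \<open>S\<close> is at most 2; as
    \<open>S\<close> is linked, \<open>third_max_indep\<close> applies.\<close>
  define E' where "E' x y \<longleftrightarrow> E x y \<or> x = u' \<and> y = w' \<or> x = w' \<and> y = u'" for x y
  interpret G: sgraph E'
    by unfold_locales (use adj_irrefl \<open>u' \<noteq> w'\<close> in \<open>auto simp: E'_def adj_commute\<close>)
  have less: "card (nb S x) \<le> 2" if "x \<in> C" "t \<in> nb C x" "t \<notin> S" for x t
  proof -
    have "nb S x \<subseteq> nb C x - {t}" using that SC by (auto simp: nb_def)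
    then have "card (nb S x) \<le> card (nb C x - {t})" using C(1) by (intro card_mono) auto
    then show ?thesis using that deg[OF that(1)] by simp
  qed
  have sub: "nb S x \<subseteq> G.nb S x" for x by (auto simp: nb_def G.nb_def E'_def)
  have G3: "card (G.nb S x) \<le> 3" if "x \<in> S" for x
  proof -
    have ins: "card (G.nb S x) \<le> 3" if "G.nb S x \<subseteq> insert y (nb S x)" "card (nb S x) \<le> 2" for y
      using card_mono[OF _ that(1)] that(2) card_insert_le_m1[of 3 "nb S x" y] finS by simp
    consider "x = u'" | "x = w'" | "x \<noteq> u'" "x \<noteq> w'" by blast
    then show ?thesis
    proof cases
      case 1
      then show ?thesis
        using less[OF outC(1) inner(1) notS(1)] \<open>u' \<noteq> w'\<close> by (intro ins[of w']) (auto simp: nb_def G.nb_def E'_def)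
    next
      case 2
      then show ?thesis
        using less[OF outC(3) inner(3) notS(3)] \<open>u' \<noteq> w'\<close> by (intro ins[of u']) (auto simp: nb_def G.nb_def E'_def)
    next
      case 3
      then have "G.nb S x \<subseteq> nb C x" using SC by (auto simp: nb_def G.nb_def E'_def)
      then show ?thesis using deg[of x] that SC C(1) card_mono[of "nb C x" "G.nb S x"] by auto
    qed
  qed
  have low: "\<exists>x\<in>R. card (G.nb S x) \<le> 2" if R: "R \<noteq> {}" "G.closed_in S R" for R
  proof -
    have "closed_in S R" using R(2) by (auto simp: closed_in_def G.closed_in_def nb_def G.nb_def E'_def)
    then have "R = S" using linkedD[OF J'(4) R(1)] by blast
    moreover have "G.nb S v' = nb S v'"
      using \<open>u' \<noteq> v'\<close> \<open>v' \<noteq> w'\<close> by (auto simp: nb_def G.nb_def E'_def)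
    ultimately show ?thesis using less[OF outC(2) inner(2) notS(2)] outS(2) by (intro bexI[of _ v']) auto
  qed
  then obtain I where I: "G.max_indep S I" "card S \<le> 3 * card I"
    using G.third_max_indep[OF finS G3 low] by blast
  have IS: "I \<subseteq> S" and indI: "indep I" and notboth: "u' \<notin> I \<or> w' \<notin> I"
    using I(1) by (auto simp: G.max_indep_def G.indep_def indep_def E'_def)
  \<comment> \<open>\<open>C\<close> has just three vertices more than \<open>S\<close>, so a corner
    without neighbours in \<open>I\<close> extends \<open>I\<close> to an independent set of at
    least a third of \<open>C\<close>, contrary to \<open>big\<close>.\<close>
  have finish: False if t: "t \<in> T" "\<And>x. x \<in> I \<Longrightarrow> \<not> E t x" for t
  proof -
    have tC: "t \<in> C" "t \<notin> I" using t CST ST(2) IS by auto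
    have ind: "indep (insert t I)" using t indI adj_irrefl by (auto simp: indep_def adj_commute)
    have "card (insert t I) = card I + 1" using tC finite_subset[OF IS finS] by simp
    moreover have "card C = card S + 3" using card_Un_disjoint[OF finS finT ST(2)] CST \<open>card T = 3\<close> by simp
    moreover have "insert t I \<subseteq> C" using tC IS SC by auto
    moreover from this have "card (cnb C (insert t I)) \<le> card C" using C(1) by (intro card_mono cnb_subset)
    ultimately show False using big[of "insert t I"] ind I(2) by simp
  qed
  from notboth show False
  proof
    assume "u' \<notin> I"
    have "\<not> E u x" if x: "x \<in> I" for x
    proof
      assume "E u x"
      then have "x \<in> nb C u" using x IS SC by (auto simp: nb_def)
      then show False using u'(1) \<open>u' \<notin> I\<close> x IS notS by auto
    qed
    then show False using finish[of u] T by auto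
  next
    assume "w' \<notin> I"
    have "\<not> E w x" if x: "x \<in> I" for x
    proof
      assume "E w x"
      then have "x \<in> nb C w" using x IS SC by (auto simp: nb_def)
      then show False using w'(1) \<open>w' \<notin> I\<close> x IS notS by auto
    qed
    then show False using finish[of w] T by auto
  qed
qed


lemma closed_in_trans:
  assumes "closed_in U Q" "closed_in Q C"
  shows "closed_in U C"
  unfolding closed_in_def
proof (intro conjI ballI)
  show "C \<subseteq> U" using assms by (auto simp: closed_in_def)
  fix u assume u: "u \<in> C"
  then have "u \<in> Q" "nb Q u \<subseteq> C" using assms(2) by (auto simp: closed_in_def)
  moreover from this have "nb U u \<subseteq> Q" using assms(1) by (auto simp: closed_in_def)
  then have "nb U u \<subseteq> nb Q u" by (auto simp: nb_def)
  ultimately show "nb U u \<subseteq> C" by blast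
qed

lemma closed_in_nb: "closed_in U Q \<Longrightarrow> u \<in> Q \<Longrightarrow> nb Q u = nb U u"
  by (auto simp: closed_in_def nb_def)

lemma closed_in_cnb: "closed_in U Q \<Longrightarrow> J \<subseteq> Q \<Longrightarrow> cnb Q J = cnb U J"
  unfolding cnb_def using closed_in_nb[of U Q] by (simp add: subset_iff)

text \<open>A nonempty closed set of least size is linked, and passing to it changes no closed
  neighbourhood.\<close>

lemma cubic_sparse_nb:
  assumes Q: "finite Q" "Q \<noteq> {}"
    and deg: "\<And>u. u \<in> Q \<Longrightarrow> card (nb Q u) = 3"
    and no_K4: "\<And>u. u \<in> Q \<Longrightarrow> \<exists>v\<in>nb Q u. \<exists>w\<in>nb Q u. v \<noteq> w \<and> \<not> E v w"
  shows "\<exists>J. J \<noteq> {} \<and> J \<subseteq> Q \<and> indep J \<and> card (cnb Q J) \<le> 3 * card J"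
proof -
  have "closed_in Q Q" by (auto simp: closed_in_def nb_def)
  then obtain C where C: "C \<noteq> {} \<and> closed_in Q C"
    and min: "\<And>W. W \<noteq> {} \<and> closed_in Q W \<Longrightarrow> card C \<le> card W"
    using ex_has_least_nat[of "\<lambda>C. C \<noteq> {} \<and> closed_in Q C" Q card] Q(2) by auto
  have CQ: "C \<subseteq> Q" and finC: "finite C"
    using C finite_subset[OF _ Q(1)] by (auto simp: closed_in_def)
  have "linked C"
    unfolding linked_def
  proof (intro allI impI)
    fix W assume W: "W \<noteq> {}" "closed_in C W"
    then have "card C \<le> card W" using min closed_in_trans C by blast
    then show "W = C" using W(2) finC by (intro card_seteq) (auto simp: closed_in_def)
  qed
  moreover have "nb C u = nb Q u" if "u \<in> C" for u using closed_in_nb C that by blast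
  ultimately have "\<exists>J. J \<noteq> {} \<and> J \<subseteq> C \<and> indep J \<and> card (cnb C J) \<le> 3 * card J"
    using C deg no_K4 CQ by (intro cubic_linked_sparse_nb[OF finC]) auto
  then show ?thesis using closed_in_cnb C CQ by (metis subset_trans)
qed

text \<open>By \<open>tight_value_5\<close> these are complete components on four vertices of weight
  2 or on three vertices of weight 3.\<close>

definition tight_clique :: "('a \<Rightarrow> nat) \<Rightarrow> 'a set \<Rightarrow> 'a set \<Rightarrow> bool" where
  "tight_clique m U Q \<longleftrightarrow> tight_set m 5 U Q \<and> (\<forall>u\<in>Q. \<forall>v\<in>Q. u \<noteq> v \<longrightarrow> E u v)"

lemma tight_clique_mono:
  assumes "finite U" "W \<subseteq> U" "\<And>u. u \<in> U \<Longrightarrow> m u + card (nb U u) \<le> 5" "tight_clique m W Q"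
  shows "tight_clique m U Q"
proof -
  have "tight_set m 5 W Q" using assms(4) by (simp add: tight_clique_def)
  then have "tight_set m 5 U Q" using tight_set_mono[where m = m and D = 5, OF assms(1,2,3)] by blast
  then show ?thesis using assms(4) by (simp add: tight_clique_def)
qed

section \<open>Greedy choice in the absence of tight cliques\<close>

lemma tight_value_5: "M\<^sup>2 + 5\<^sup>2 div 4 = 5 * M \<longleftrightarrow> M = 2 \<or> M = (3::nat)"
proof
  assume "M\<^sup>2 + 5\<^sup>2 div 4 = 5 * M"
  then have *: "M * M + 6 = 5 * M" by (simp add: power2_eq_square)
  have "M < 6"
  proof (rule ccontr)
    assume "\<not> M < 6"
    then have "6 * M \<le> M * M" by simp
    then show False using * by linarith
  qed
  then consider "M = 0" | "M = 1" | "M = 2" | "M = 3" | "M = 4" | "M = 5" by linarith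
  then show "M = 2 \<or> M = 3" using * by cases auto
qed (auto simp: power2_eq_square)

text \<open>All vertices of the closed neighbourhood have the same degree as \<open>u\<close> and
  already reach it inside this clique, so no edge leaves it.\<close>

lemma tight_cliqueI:
  assumes U: "finite U" "u \<in> U" and M: "M = 2 \<or> M = 3"
    and Q: "\<And>v. v \<in> insert u (nb U u) \<Longrightarrow> m v = M \<and> M + card (nb U v) = 5"
    and clique: "\<And>v w. v \<in> nb U u \<Longrightarrow> w \<in> nb U u \<Longrightarrow> v \<noteq> w \<Longrightarrow> E v w"
  shows "tight_clique m U (insert u (nb U u))"
proof -
  let ?Q = "insert u (nb U u)"
  have QU: "?Q \<subseteq> U" using U nb_subset by auto
  have adj: "E v w" if "v \<in> ?Q" "w \<in> ?Q" "v \<noteq> w" for v w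
  proof (cases "v = u \<or> w = u")
    case True
    then show ?thesis using that by (auto simp: nb_def adj_commute)
  next
    case False
    then show ?thesis using that clique by blast
  qed
  have "nb U v \<subseteq> ?Q" if v: "v \<in> ?Q" for v
  proof -
    have "?Q - {v} \<subseteq> nb U v"
    proof
      fix x assume x: "x \<in> ?Q - {v}"
      then have "E v x" using adj[OF v, of x] by blast
      then show "x \<in> nb U v" using x QU by (auto simp: nb_def)
    qed
    moreover have "card (?Q - {v}) = card (nb U u)" using v U by (simp add: card_Diff_singleton)
    moreover have "card (nb U u) = card (nb U v)" using Q[OF v] Q[of u] by simp
    ultimately have "?Q - {v} = nb U v" using U by (intro card_seteq) auto
    then show ?thesis by auto
  qed
  then show ?thesis
    unfolding tight_clique_def tight_set_def closed_in_def
  proof (intro conjI exI[of _ M] ballI impI)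
    show "M\<^sup>2 + 5\<^sup>2 div 4 = 5 * M" using tight_value_5 M by blast
  qed (use QU adj Q in blast)+
qed

text \<open>If no single vertex can be chosen, comparing \<open>9 * (M - 1)\<close> with
  \<open>(6 - M) * (4 * M - 5)\<close> leaves only \<open>M = 2\<close> and \<open>M = 3\<close>,
  and the vertices of largest weight form a closed regular set. Without tight cliques, larger
  independent sets inside it are cheap enough: cubic graphs for \<open>M = 2\<close>, unions of
  cycles of length at least 4 for \<open>M = 3\<close>.\<close>

lemma greedy_step_no_tight_clique:
  assumes U: "finite U" "U \<noteq> {}"
    and m: "\<And>u. u \<in> U \<Longrightarrow> 1 \<le> m u" "\<And>u. u \<in> U \<Longrightarrow> m u + card (nb U u) \<le> 5"
    and nt: "\<And>Q. \<not> tight_clique m U Q"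
  shows "\<exists>J. J \<noteq> {} \<and> J \<subseteq> U \<and> indep J \<and>
    (\<Sum>v\<in>cnb U J. 4 * int (m v) - 5) \<le> (\<Sum>h\<in>J. 9 * (int (m h) - 1))"
proof (rule ccontr)
  assume "\<not> ?thesis"
  then have big: "(\<Sum>h\<in>J. 9 * (int (m h) - 1)) < (\<Sum>v\<in>cnb U J. 4 * int (m v) - 5)"
    if "J \<noteq> {}" "J \<subseteq> U" "indep J" for J using that by force
  define M where "M = Max (m ` U)"
  have M_ge: "m u \<le> M" if "u \<in> U" for u using that U by (simp add: M_def)
  have "M \<in> m ` U" unfolding M_def using U by (intro Max_in) auto
  then obtain h0 where h0: "h0 \<in> U" "m h0 = M" by blast
  have M1: "1 \<le> M" "M \<le> 5" using m(1)[OF h0(1)] m(2)[OF h0(1)] h0(2) by auto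
  define Q where "Q = {u \<in> U. m u = M}"
  have fails: "9 * (int M - 1) < (\<Sum>v\<in>insert h (nb U h). 4 * int (m v) - 5)" if "h \<in> Q" for h
    using big[of "{h}"] that by (simp add: Q_def)
  have cost: "4 * int (m v) - 5 \<le> 4 * int M - 5" if "h \<in> Q" "v \<in> insert h (nb U h)" for h v
    using that M_ge[of v] nb_subset[of U h] by (auto simp: Q_def)
  have key: "(M = 2 \<or> M = 3) \<and> M + card (nb U h) = 5 \<and> nb U h \<subseteq> Q" if h: "h \<in> Q" for h
  proof -
    have deg: "card (nb U h) + M \<le> 5" using m(2)[of h] h by (auto simp: Q_def)
    have 1: "9 * (int M - 1) < (int (card (nb U h)) + 1) * (4 * int M - 5)"
      using fails[OF h] sum_cost_cnb_le[OF U(1) cost[OF h]] by (meson less_le_trans)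
    \<comment> \<open>A lighter neighbour saves at least 4, while the deficit to be covered is only
      3 for \<open>M = 2\<close> and \<open>M = 3\<close>.\<close>
    have sub: "nb U h \<subseteq> Q" if "9 * (int M - 1) \<ge> (int (card (nb U h)) + 1) * (4 * int M - 5) - 4"
    proof (rule ccontr)
      assume "\<not> nb U h \<subseteq> Q"
      then obtain w where w: "w \<in> nb U h" "m w \<noteq> M" using nb_subset[of U h] by (auto simp: Q_def)
      then have "m w < M" using M_ge[of w] nb_subset[of U h] by auto
      then have "4 * int (m w) - 5 \<le> (4 * int M - 5) - 4" by linarith
      then have "(\<Sum>v\<in>insert h (nb U h). 4 * int (m v) - 5) \<le> (int (card (nb U h)) + 1) * (4 * int M - 5) - 4"
        using w(1) by (intro sum_cost_cnb_less[OF U(1) cost[OF h]]) auto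
      then show False using fails[OF h] that by linarith
    qed
    consider "M = 1" | "M = 2" | "M = 3" | "M = 4" | "M = 5" using M1 by linarith
    then show ?thesis
    proof cases
      case 1
      then show ?thesis using \<open>9 * (int M - 1) < _\<close> by simp
    next
      case 2
      then show ?thesis using 1 deg sub by simp
    next
      case 3
      then show ?thesis using 1 deg sub by simp
    next
      case 4
      then show ?thesis using 1 deg by simp
    next
      case 5
      then show ?thesis using 1 deg by simp
    qed
  qed
  have h0Q: "h0 \<in> Q" using h0 by (simp add: Q_def)
  have QU: "closed_in U Q" using key by (auto simp: closed_in_def Q_def)
  then have subQ: "Q \<subseteq> U" by (simp add: closed_in_def)
  have finQ: "finite Q" using U by (simp add: Q_def)
  have not_clique: "\<exists>v\<in>nb U u. \<exists>w\<in>nb U u. v \<noteq> w \<and> \<not> E v w" if u: "u \<in> Q" for u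
  proof (rule ccontr)
    assume "\<not> ?thesis"
    then have "E v w" if "v \<in> nb U u" "w \<in> nb U u" "v \<noteq> w" for v w using that by blast
    moreover have "m v = M \<and> M + card (nb U v) = 5" if "v \<in> insert u (nb U u)" for v
      using that key[of v] key[OF u] u by (auto simp: Q_def)
    ultimately have "tight_clique m U (insert u (nb U u))"
      using u key[OF u] subQ U by (intro tight_cliqueI[of _ _ M]) auto
    then show False using nt by blast
  qed
  have sumQ: "(\<Sum>v\<in>A. 4 * int (m v) - 5) = int (card A) * (4 * int M - 5)" if "A \<subseteq> Q" for A
  proof -
    have "(\<Sum>v\<in>A. 4 * int (m v) - 5) = (\<Sum>v\<in>A. 4 * int M - 5)" using that by (intro sum.cong) (auto simp: Q_def)
    then show ?thesis by simp
  qed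
  have sumJ: "(\<Sum>h\<in>J. 9 * (int (m h) - 1)) = int (card J) * (9 * (int M - 1))" if "J \<subseteq> Q" for J
  proof -
    have "(\<Sum>h\<in>J. 9 * (int (m h) - 1)) = (\<Sum>h\<in>J. 9 * (int M - 1))" using that by (intro sum.cong) (auto simp: Q_def)
    then show ?thesis by simp
  qed
  from key[OF h0Q] consider "M = 2" | "M = 3" by blast
  then show False
  proof cases
    case 1
    have nbQ: "nb Q u = nb U u" if "u \<in> Q" for u using closed_in_nb[OF QU that] .
    \<comment> \<open>Each vertex costs 3 and each chosen vertex gains 9, so three vertices per
      chosen one are exactly paid for.\<close>
    have "\<exists>J. J \<noteq> {} \<and> J \<subseteq> Q \<and> indep J \<and> card (cnb Q J) \<le> 3 * card J"
    proof (rule cubic_sparse_nb[OF finQ])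
      show "Q \<noteq> {}" using h0Q by blast
      show "card (nb Q u) = 3" if "u \<in> Q" for u using key[OF that] nbQ[OF that] 1 by simp
      show "\<exists>v\<in>nb Q u. \<exists>w\<in>nb Q u. v \<noteq> w \<and> \<not> E v w" if "u \<in> Q" for u
        unfolding nbQ[OF that] by (rule not_clique[OF that])
    qed
    then obtain J where J: "J \<noteq> {}" "J \<subseteq> Q" "indep J" "card (cnb Q J) \<le> 3 * card J" by blast
    have "cnb U J = cnb Q J" using closed_in_cnb[OF QU J(2)] by simp
    then show False
      using big[OF J(1) subset_trans[OF J(2) subQ] J(3)] J(4) sumQ[OF cnb_subset[OF J(2)]] sumJ[OF J(2)] 1 by simp
  next
    case 2
    \<comment> \<open>On the path \<open>b\<close>, \<open>h0\<close>, \<open>a\<close>,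
      \<open>c\<close>, \<open>e\<close> the vertices \<open>h0\<close> and \<open>c\<close> have at
      most five vertices in their closed neighbourhood (\<open>e\<close> may equal
      \<open>b\<close>), at cost at most 35, and together they gain 36.\<close>
    obtain a b where ab: "a \<in> nb U h0" "b \<in> nb U h0" "a \<noteq> b" "\<not> E a b"
      using not_clique[OF h0Q] by blast
    have "card (nb U h0) = 2" using key[OF h0Q] 2 by simp
    then have nh: "nb U h0 = {a, b}" using ab U by (intro card_seteq[symmetric]) auto
    have aQ: "a \<in> Q" "b \<in> Q" using key[OF h0Q] ab by auto
    have "card (nb U a) = 2" "h0 \<in> nb U a" using key[OF aQ(1)] 2 ab(1) h0(1) by (auto simp: nb_def adj_commute)
    then obtain c where c: "nb U a = {h0, c}" "c \<noteq> h0"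
      by (metis card_2_iff doubleton_eq_iff insertE singletonD)
    have cQ: "c \<in> Q" using key[OF aQ(1)] c by auto
    have cab: "c \<noteq> a" "c \<noteq> b" using c(1) nb_notin[of a U] ab(4) by (auto simp: nb_def set_eq_iff)
    have "c \<notin> nb U h0" using cab nh by auto
    then have ind: "indep {h0, c}" using cQ subQ adj_irrefl by (auto simp: indep_def nb_def adj_commute)
    have "card (nb U c) = 2" "a \<in> nb U c" using key[OF cQ] 2 c(1) aQ subQ by (auto simp: nb_def set_eq_iff adj_commute)
    then obtain e where e: "nb U c = {a, e}" by (metis card_2_iff doubleton_eq_iff insertE singletonD)
    have sub: "cnb U {h0, c} \<subseteq> set [h0, a, b, c, e]" using nh e by (auto simp: cnb_def)
    then have "card (cnb U {h0, c}) \<le> 5"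
      using card_mono[OF _ sub] card_length[of "[h0, a, b, c, e]"] by simp
    moreover have "cnb U {h0, c} \<subseteq> Q" using key[OF cQ] key[OF h0Q] cQ h0Q by (auto simp: cnb_def)
    ultimately show False
      using big[of "{h0, c}"] ind h0Q cQ subQ sumQ[of "cnb U {h0, c}"] sumJ[of "{h0, c}"] c(2) 2 by auto
  qed
qed

lemma weighted_greedy_no_tight_clique:
  assumes U: "finite U"
    and m: "\<And>u. u \<in> U \<Longrightarrow> 1 \<le> m u" "\<And>u. u \<in> U \<Longrightarrow> m u + card (nb U u) \<le> 5"
    and nt: "\<And>Q. \<not> tight_clique m U Q"
  shows "\<exists>I. max_indep U I \<and> (\<Sum>u\<in>U. 4 * int (m u) - 5) \<le> (\<Sum>h\<in>I. 9 * (int (m h) - 1))"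
proof (rule greedy_max_indep[where P = "\<lambda>_. True", OF U])
  fix W assume W: "W \<subseteq> U" "W \<noteq> {}"
  have "\<exists>J. J \<noteq> {} \<and> J \<subseteq> W \<and> indep J \<and>
    (\<Sum>v\<in>cnb W J. 4 * int (m v) - 5) \<le> (\<Sum>h\<in>J. 9 * (int (m h) - 1))"
  proof (rule greedy_step_no_tight_clique)
    show "finite W" using W(1) U by (rule finite_subset)
    show "1 \<le> m u" if "u \<in> W" for u using m(1) W(1) that by blast
    show "m u + card (nb W u) \<le> 5" if "u \<in> W" for u
      using m(2)[of u] that W card_mono[OF finite_nb[OF U] nb_mono[OF W(1)], of u] by fastforce
    show "\<not> tight_clique m W Q" for Q
      using tight_clique_mono[OF U W(1) m(2)] nt by blast
  qed (rule W(2))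
  then show "\<exists>J. J \<noteq> {} \<and> J \<subseteq> W \<and> indep J \<and>
    (\<Sum>v\<in>cnb W J. 4 * int (m v) - 5) \<le> (\<Sum>h\<in>J. 9 * (int (m h) - 1)) \<and> True" by simp
qed simp

end

subsection \<open>Tight cliques for degree five\<close>

context fin_sgraph begin

text \<open>The closed neighbourhood of \<open>u\<close> among the hubs. For a hub it is a clique
  and a whole component exactly when all its members have the same block, which is how the next
  definitions express this.\<close>

definition block :: "('a \<Rightarrow> 'a) \<Rightarrow> 'a \<Rightarrow> 'a set" where
  "block p u = insert u (nb (hubs p) u)"

text \<open>\<open>tight_at\<close> says that the component of \<open>u\<close> among the hubs is a tight clique, \<open>pretight_at\<close> that
  it becomes one when a single further leaf is added.\<close>

definition tight_at :: "('a \<Rightarrow> 'a) \<Rightarrow> nat \<Rightarrow> 'a \<Rightarrow> bool" where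
  "tight_at p M u \<longleftrightarrow> (M = 2 \<or> M = 3) \<and> card (block p u) + M = 6 \<and>
     (\<forall>v\<in>block p u. block p v = block p u \<and> card (leaves p v) = M)"

definition pretight_at :: "('a \<Rightarrow> 'a) \<Rightarrow> nat \<Rightarrow> 'a \<Rightarrow> bool" where
  "pretight_at p M u \<longleftrightarrow> (M = 2 \<or> M = 3) \<and> card (block p u) + M = 6 \<and>
     (\<forall>v\<in>block p u. block p v = block p u) \<and>
     (\<exists>w\<in>block p u. card (leaves p w) + 1 = M \<and> (\<forall>v\<in>block p u - {w}. card (leaves p v) = M))"

definition special :: "('a \<Rightarrow> 'a) \<Rightarrow> 'a \<Rightarrow> bool" where
  "special p u \<longleftrightarrow> (\<exists>M. tight_at p M u \<or> pretight_at p M u)"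

text \<open>At most one tight block is demanded here; that there is one comes from the assumption
  \<open>always_tight\<close> below.\<close>

definition uniquely_tight :: "('a \<Rightarrow> 'a) \<Rightarrow> bool" where
  "uniquely_tight p \<longleftrightarrow> star p \<and>
     (\<forall>u\<in>hubs p. \<forall>v\<in>hubs p. \<forall>M N. tight_at p M u \<longrightarrow> tight_at p N v \<longrightarrow> block p u = block p v)"

lemma self_in_block [simp]: "u \<in> block p u"
  by (simp add: block_def)

lemma block_subset: "u \<in> hubs p \<Longrightarrow> block p u \<subseteq> hubs p"
  using nb_subset by (auto simp: block_def)

lemma finite_block [simp]: "finite (block p u)"
  by (simp add: block_def)

lemma card_block: "card (block p u) = card (nb (hubs p) u) + 1"
  by (simp add: block_def)

lemma adj_in_block: "E u v \<Longrightarrow> v \<in> hubs p \<Longrightarrow> v \<in> block p u"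
  by (simp add: block_def nb_def)

lemma block_sym: "v \<in> block p u \<Longrightarrow> u \<in> hubs p \<Longrightarrow> u \<in> block p v"
  by (auto simp: block_def nb_def adj_commute)

lemma tight_atD:
  assumes "tight_at p M u"
  shows "M = 2 \<or> M = 3" "card (block p u) + M = 6"
    and "v \<in> block p u \<Longrightarrow> block p v = block p u" "v \<in> block p u \<Longrightarrow> card (leaves p v) = M"
proof -
  note * = assms[unfolded tight_at_def]
  show "M = 2 \<or> M = 3" using * by (rule conjunct1)
  show "card (block p u) + M = 6" using conjunct2[OF *] by (rule conjunct1)
  have c: "\<forall>v\<in>block p u. block p v = block p u \<and> card (leaves p v) = M"
    using conjunct2[OF *] by (rule conjunct2)
  show "v \<in> block p u \<Longrightarrow> block p v = block p u" by (rule conjunct1[OF bspec[OF c]])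
  show "v \<in> block p u \<Longrightarrow> card (leaves p v) = M" by (rule conjunct2[OF bspec[OF c]])
qed

lemma pretight_atD:
  assumes "pretight_at p M u"
  shows "M = 2 \<or> M = 3" "card (block p u) + M = 6"
    and "v \<in> block p u \<Longrightarrow> block p v = block p u"
    and "\<exists>w\<in>block p u. card (leaves p w) + 1 = M \<and> (\<forall>v\<in>block p u - {w}. card (leaves p v) = M)"
proof -
  note * = assms[unfolded pretight_at_def]
  note ** = conjunct2[OF conjunct2[OF *]]
  show "M = 2 \<or> M = 3" using * by (rule conjunct1)
  show "card (block p u) + M = 6" using conjunct2[OF *] by (rule conjunct1)
  show "v \<in> block p u \<Longrightarrow> block p v = block p u" by (rule bspec[OF conjunct1[OF **]])
  show "\<exists>w\<in>block p u. card (leaves p w) + 1 = M \<and> (\<forall>v\<in>block p u - {w}. card (leaves p v) = M)"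
    using ** by (rule conjunct2)
qed

lemma tight_at_block:
  assumes "tight_at p M u" "v \<in> block p u"
  shows "tight_at p M v"
  using assms(1) unfolding tight_at_def tight_atD(3)[OF assms] .

lemma pretight_at_block:
  assumes "pretight_at p M u" "v \<in> block p u"
  shows "pretight_at p M v"
  using assms(1) unfolding pretight_at_def pretight_atD(3)[OF assms] .

lemma special_cong:
  assumes "\<And>w. w \<in> block p u \<Longrightarrow> block p' w = block p w"
    and "\<And>w. w \<in> block p u \<Longrightarrow> leaves p' w = leaves p w"
  shows "tight_at p' M u \<longleftrightarrow> tight_at p M u" "special p' u \<longleftrightarrow> special p u"
proof -
  have 1: "block p' u = block p u" by (rule assms(1)) simp
  note conj = arg_cong2[where f = "(\<and>)"]
  show "tight_at p' M u \<longleftrightarrow> tight_at p M u" for M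
    unfolding tight_at_def 1 by (intro conj refl ball_cong) (simp_all add: assms)
  moreover have "pretight_at p' M u \<longleftrightarrow> pretight_at p M u" for M
    unfolding pretight_at_def 1 by (intro conj refl ball_cong bex_cong) (simp_all add: assms)
  ultimately show "special p' u \<longleftrightarrow> special p u" by (simp add: special_def)
qed

lemma special_block: "special p u \<Longrightarrow> v \<in> block p u \<Longrightarrow> special p v"
  using tight_at_block pretight_at_block unfolding special_def by blast

lemma special_block_eq: "special p u \<Longrightarrow> v \<in> block p u \<Longrightarrow> block p v = block p u"
  unfolding special_def using tight_atD(3) pretight_atD(3) by blast

lemma tight_at_other:
  assumes "tight_at p M u"
  shows "\<exists>w\<in>block p u. w \<noteq> x \<and> w \<noteq> y"
proof -
  have "3 \<le> card (block p u)" using tight_atD(1,2)[OF assms] by auto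
  moreover have "card {x, y} \<le> 2" by (simp add: card_insert_if)
  ultimately have "\<not> block p u \<subseteq> {x, y}" using card_mono[of "{x, y}" "block p u"] by fastforce
  then show ?thesis by blast
qed

lemma tight_clique_tight_at:
  assumes "tight_clique (\<lambda>x. card (leaves p x)) (hubs p) Q" "u \<in> Q"
  shows "\<exists>M. tight_at p M u" "u \<in> hubs p"
proof -
  obtain M where M: "M\<^sup>2 + 5\<^sup>2 div 4 = 5 * M" "\<And>v. v \<in> Q \<Longrightarrow> card (leaves p v) = M \<and> M + card (nb (hubs p) v) = 5"
    and Q: "Q \<subseteq> hubs p" "\<And>v. v \<in> Q \<Longrightarrow> nb (hubs p) v \<subseteq> Q" "\<And>v w. v \<in> Q \<Longrightarrow> w \<in> Q \<Longrightarrow> v \<noteq> w \<Longrightarrow> E v w"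
    using assms(1) unfolding tight_clique_def tight_set_def closed_in_def by blast
  have eq: "block p v = Q" if v: "v \<in> Q" for v
  proof
    show "block p v \<subseteq> Q" using Q(2)[OF v] v by (simp add: block_def)
    show "Q \<subseteq> block p v" using Q(1) Q(3)[OF v] adj_in_block self_in_block by blast
  qed
  have "tight_at p M u"
    unfolding tight_at_def
  proof (intro conjI ballI)
    show "M = 2 \<or> M = 3" using M(1) tight_value_5 by blast
    show "card (block p u) + M = 6" using card_block[of p u] M(2)[OF assms(2)] by simp
  qed (use eq M(2) assms(2) in simp_all)
  then show "\<exists>M. tight_at p M u" by blast
  show "u \<in> hubs p" using assms(2) Q(1) by blast
qed

lemma tight_at_full:
  assumes p: "prestar p" and deg: "\<And>v. v \<in> V \<Longrightarrow> card (nb V v) \<le> 5"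
    and u: "u \<in> hubs p" "tight_at p M u" and x: "x \<in> block p u"
  shows "nb V x = leaves p x \<union> nb (hubs p) x" "nb V x \<subseteq> {w \<in> V. p w \<in> block p u}"
    "2 \<le> card (leaves p x)"
proof -
  have xh: "x \<in> hubs p" using block_subset[OF u(1)] x by blast
  have M: "card (leaves p x) = M" "block p x = block p u" "card (block p x) + M = 6" "2 \<le> M"
    using tight_atD(1,2)[OF u(2)] tight_atD(3,4)[OF u(2) x] by auto
  have "card (leaves p x) + card (nb (hubs p) x) = 5" using M card_block[of p x] by simp
  moreover have "card (nb V x) \<le> 5" using deg[of x] xh hubs_subset[of p] by auto
  ultimately show eq: "nb V x = leaves p x \<union> nb (hubs p) x"
    by (intro full_hub_neighbours[OF p xh]) simp
  have "p w \<in> block p u" if "w \<in> nb (hubs p) x" for w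
    using that M(2) by (auto simp: block_def nb_def hubs_def)
  moreover have "p w \<in> block p u" if "w \<in> leaves p x" for w
    using that x by (auto simp: leaves_def)
  ultimately show "nb V x \<subseteq> {w \<in> V. p w \<in> block p u}"
    using eq nb_subset[of V x] by blast
  show "2 \<le> card (leaves p x)" using M by simp
qed

section \<open>Shifting a leaf out of the only tight block\<close>

context
  assumes deg: "\<And>v. v \<in> V \<Longrightarrow> card (nb V v) \<le> 5"
    and always_tight: "\<And>p. star p \<Longrightarrow> \<exists>u\<in>hubs p. \<exists>M. tight_at p M u"
begin

context
  fixes p y z M
  assumes p: "uniquely_tight p" and tight: "tight_at p M (p y)"
    and yz: "E y z" "p y \<noteq> y" "p z \<notin> block p (p y)"
begin

lemma shift_basics:
  "prestar p" "star p" "y \<in> V" "z \<in> V" "y \<noteq> z" "p y \<in> hubs p" "y \<notin> hubs p" "y \<in> leaves p (p y)"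
  "leaves p y = {}" "p z \<noteq> p y" "p z \<in> hubs p" "2 \<le> card (leaves p (p y))"
  "star (attach p y z)" "2 \<le> M" "card (leaves p (p y)) = M" "y \<noteq> p z" "z \<noteq> p y"
proof -
  show s: "star p" using p by (simp add: uniquely_tight_def)
  then show pre: "prestar p" by (simp add: star_def)
  show yV: "y \<in> V" and zV: "z \<in> V" using yz adj_in_V adj_in_V2 by auto
  show yh: "p y \<in> hubs p" and "p z \<in> hubs p" using hub_fixed[OF pre] yV zV by auto
  show "y \<notin> hubs p" using yz(2) by (simp add: hubs_def)
  show "y \<in> leaves p (p y)" using yV yz(2) by (simp add: leaves_def)
  show ly: "leaves p y = {}" using leaves_nonhub[OF pre yz(2)] .
  show ne: "p z \<noteq> p y" using yz(3) by auto
  show c: "2 \<le> card (leaves p (p y))" using tight_at_full(3)[OF pre deg yh tight] by simp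
  have "leaves p (p y) \<noteq> {y}" using c by auto
  then show "star (attach p y z)" by (rule attach_star[OF pre yz(1) ne ly s])
  show "2 \<le> M" "card (leaves p (p y)) = M" using tight_atD(1)[OF tight] tight_atD(4)[OF tight, of "p y"] by auto
  show "y \<noteq> z" "y \<noteq> p z" "z \<noteq> p y" using attach_distinct[OF pre yz(1) ne ly] by auto
qed

lemma y_leaf_only: "w \<noteq> p y \<Longrightarrow> y \<notin> leaves p w"
  by (auto simp: leaves_def)

lemma not_adj_block: "w \<in> block p (p y) \<Longrightarrow> \<not> E w z"
  using tight_at_full(2)[OF shift_basics(1) deg shift_basics(6) tight, of w] yz(3) shift_basics(4)
  by (auto simp: nb_def)

lemma tight_eq: "v \<in> hubs p \<Longrightarrow> tight_at p N v \<Longrightarrow> block p v = block p (p y)"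
  using p tight shift_basics(6) unfolding uniquely_tight_def by blast

text \<open>The shift spoils the tight block: its hub \<open>p y\<close> has lost a leaf, another hub has not.\<close>

lemma no_tight_away:
  assumes v: "v \<in> hubs p" "tight_at p' N v"
    and blocks: "\<And>w. w \<in> block p' v \<Longrightarrow> block p w = block p' w"
    and same: "\<And>w. w \<in> block p' v \<Longrightarrow> leaves p' w = leaves p w - {y}"
  shows False
proof (cases "p y \<in> block p' v")
  case True
  have "block p (p y) = block p' v" using blocks[OF True] tight_atD(3)[OF v(2) True] by simp
  moreover obtain w where w: "w \<in> block p (p y)" "w \<noteq> p y" using tight_at_other[OF tight] by blast
  ultimately have "card (leaves p' w) = card (leaves p' (p y))" using tight_atD(4)[OF v(2)] True by simp
  moreover have "leaves p' w = leaves p w" using same[of w] y_leaf_only[OF w(2)] w \<open>block p (p y) = _\<close> by simp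
  moreover have "card (leaves p w) = M" using tight_atD(4)[OF tight w(1)] .
  moreover have "card (leaves p' (p y)) = M - 1"
    using same[OF True] shift_basics(8,15) by simp
  ultimately show False using shift_basics(14) by simp
next
  case False
  have same': "leaves p w = leaves p' w" if "w \<in> block p' v" for w
    using same[OF that] y_leaf_only[of w] False that by auto
  \<comment> \<open>The block of \<open>v\<close> is unchanged and was tight before the shift; by
    uniqueness it is the block of \<open>p y\<close>.\<close>
  have "tight_at p N v" using special_cong(1)[OF blocks same'] v(2) by blast
  then have "p y \<in> block p v" using tight_eq[OF v(1)] by simp
  then show False using False blocks[of v] by simp
qed

text \<open>The hubs and hence all blocks stay the same; only \<open>p y\<close> loses a leaf and
  only \<open>z\<close> gains one. The tight block after the shift must therefore contain
  \<open>z\<close>, so it was pretight before, while the old tight block becomes pretight.\<close>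

lemma shift_hub:
  assumes z: "z \<in> hubs p"
  shows "uniquely_tight (attach p y z)" "hubs (attach p y z) = hubs p"
    "\<exists>N. pretight_at p N z" "\<And>u. u \<in> hubs p \<Longrightarrow> special (attach p y z) u \<longleftrightarrow> special p u"
proof -
  let ?p' = "attach p y z"
  note b = shift_basics
  have pz: "p z = z" using z by (simp add: hubs_def)
  note att = attach_hub[OF b(1) yz(1) b(10,9) pz]
  show hubs: "hubs ?p' = hubs p" using att(2) b(7) by simp
  have block: "block ?p' u = block p u" for u by (simp add: block_def hubs)
  have leaves_z: "card (leaves ?p' z) = card (leaves p z) + 1"
    using att(3) y_leaf_only[of z] b(17) by simp
  have leaves_x: "card (leaves ?p' (p y)) + 1 = M" using att(4)[of "p y"] b by simp
  have leaves_o: "leaves ?p' w = leaves p w" if "w \<noteq> z" "w \<noteq> p y" for w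
    using att(4)[of w] y_leaf_only[of w] that by simp
  have zx: "z \<notin> block p (p y)" using yz(3) pz by simp
  have in_z: "z \<in> block p v" if v: "v \<in> hubs p" "tight_at ?p' N v" for v N
  proof (rule ccontr)
    assume n: "z \<notin> block p v"
    show False
    proof (rule no_tight_away[OF v])
      show "leaves ?p' w = leaves p w - {y}" if "w \<in> block ?p' v" for w
        using att(4)[of w] that n block by auto
    qed (simp add: block)
  qed
  have tight_z: "tight_at ?p' N z \<and> block p v = block p z" if v: "v \<in> hubs p" "tight_at ?p' N v" for v N
    using tight_at_block[OF v(2), of z] tight_atD(3)[OF v(2), of z] in_z[OF v] block by simp
  show "uniquely_tight ?p'"
    unfolding uniquely_tight_def hubs block using b(13) tight_z by metis
  obtain v N where v: "v \<in> hubs p" "tight_at ?p' N v" using always_tight[OF b(13)] hubs by auto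
  have tz: "tight_at ?p' N z" using tight_z[OF v] by blast
  have x_z: "p y \<notin> block p z" using block_sym[of "p y" p z] zx z by blast
  have pre_z: "pretight_at p N z"
    unfolding pretight_at_def
  proof (intro conjI bexI[of _ z] ballI)
    show "card (leaves p z) + 1 = N" using tight_atD(4)[OF tz, of z] leaves_z by simp
    fix w assume w: "w \<in> block p z - {z}"
    then have "w \<noteq> p y" using x_z by blast
    then show "card (leaves p w) = N" using tight_atD(4)[OF tz, of w] w leaves_o[of w] block by simp
  qed (use tight_atD(1-3)[OF tz, unfolded block] self_in_block[of z p] in blast)+
  then show "\<exists>N. pretight_at p N z" by blast
  have pre_x: "pretight_at ?p' M (p y)"
    unfolding pretight_at_def block
  proof (intro conjI bexI[of _ "p y"] ballI)
    show "card (leaves ?p' (p y)) + 1 = M" by (rule leaves_x)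
    fix w assume w: "w \<in> block p (p y) - {p y}"
    then have "w \<noteq> z" using zx by blast
    then show "card (leaves ?p' w) = M" using tight_atD(4)[OF tight, of w] w leaves_o[of w] by simp
  qed (use tight_atD(1-3)[OF tight] self_in_block[of "p y" p] in blast)+
  show "special ?p' u \<longleftrightarrow> special p u" if u: "u \<in> hubs p" for u
  proof -
    consider "u \<in> block p (p y)" | "u \<in> block p z" | "u \<notin> block p (p y)" "u \<notin> block p z" by blast
    then show ?thesis
    proof cases
      case 1
      then have "special p u" "special ?p' u"
        using tight_at_block[OF tight] pretight_at_block[OF pre_x, of u] block unfolding special_def by auto
      then show ?thesis by simp
    next
      case 2
      then have "special p u" "special ?p' u"
        using tight_at_block[OF tz, of u] pretight_at_block[OF pre_z] block unfolding special_def by auto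
      then show ?thesis by simp
    next
      case 3
      then have "p y \<notin> block p u" "z \<notin> block p u" using block_sym u by blast+
      then have "leaves ?p' w = leaves p w" if "w \<in> block p u" for w using leaves_o that by metis
      then show ?thesis using special_cong(2)[of p u ?p'] block by blast
    qed
  qed
qed

end

context
  fixes p y z M
  assumes p: "uniquely_tight p" and tight: "tight_at p M (p y)"
    and yz: "E y z" "p y \<noteq> y" "p z \<notin> block p (p y)"
begin

lemmas basics = shift_basics[OF p tight yz]
lemmas y_leaf = y_leaf_only[OF p tight yz]
lemmas away = no_tight_away[OF p tight yz]
lemmas not_adj = not_adj_block[OF p tight yz]

text \<open>The promoted hub \<open>z\<close> has the single leaf \<open>y\<close> and lies in no
  tight block, and neither does its neighbour \<open>p z\<close>, which remains a hub. A tight block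
  after the shift is then out of reach of the change, contrary to
  \<open>no_tight_away\<close>.\<close>

lemma shift_leaf_impossible:
  assumes z: "z \<notin> hubs p" and more: "leaves p (p z) \<noteq> {z}"
  shows False
proof -
  let ?p' = "attach p y z"
  note b = basics
  have pz: "p z \<noteq> z" using z b(4) by (auto simp: hubs_def)
  note att = attach_leaf[OF b(1) yz(1) b(10,9) pz more]
  have hubs: "hubs ?p' = insert z (hubs p)" using att(2) b(7) by simp
  obtain v N where v: "v \<in> hubs ?p'" "tight_at ?p' N v" using always_tight[OF b(13)] by auto
  have eq: "block ?p' w = block ?p' v" if "w \<in> block ?p' v" for w using tight_atD(3)[OF v(2) that] .
  have z_notin: "z \<notin> block ?p' v"
  proof
    assume "z \<in> block ?p' v"
    then have "2 \<le> card (leaves ?p' z)" using tight_atD(1)[OF v(2)] tight_atD(4)[OF v(2), of z] by auto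
    then show False using att(3) by simp
  qed
  have vh: "v \<in> hubs p" using v(1) hubs z_notin self_in_block[of v ?p'] by auto
  have "E (p z) z" using b(1,4) pz by (auto simp: prestar_def adj_commute)
  then have pz_notin: "p z \<notin> block ?p' v"
    using z_notin eq[of "p z"] adj_in_block[of "p z" z ?p'] hubs by auto
  show False
  proof (rule away[OF vh v(2)])
    fix w assume w: "w \<in> block ?p' v"
    then have "z \<notin> block ?p' w" using eq[OF w] z_notin by simp
    then show "block p w = block ?p' w" by (auto simp: block_def nb_def hubs)
    have "z \<notin> leaves p w" using w pz_notin by (auto simp: leaves_def)
    moreover have "w \<noteq> z" using w z_notin by auto
    ultimately show "leaves ?p' w = leaves p w - {y}" using att(4)[of w] by auto
  qed
qed

text \<open>Now \<open>z\<close> replaces \<open>p z\<close> as a hub and has the two leaves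
  \<open>p z\<close> and \<open>y\<close>. The new tight block contains \<open>z\<close>, so it has
  four hubs with two leaves each. The three besides \<open>z\<close> were not special before and are
  special now, and no hub ceases to be special.\<close>

lemma shift_single_leaf:
  assumes z: "z \<notin> hubs p" and single: "leaves p (p z) = {z}"
  shows "uniquely_tight (attach p y z)"
    "{u \<in> hubs (attach p y z). \<not> special (attach p y z) u} \<subset> {u \<in> hubs p. \<not> special p u}"
proof -
  let ?p' = "attach p y z" and ?q = "p z"
  note b = basics
  have pz: "p z \<noteq> z" using z b(4) by (auto simp: hubs_def)
  note att = attach_single_leaf[OF b(1) yz(1) b(10,9) pz single]
  have hubs: "hubs ?p' = insert z (hubs p - {?q})" using att(2) b(7) by auto
  have pre': "prestar ?p'" using b(13) by (simp add: star_def)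
  have q': "?q \<notin> hubs ?p'" "?p' ?q = z" "?q \<in> leaves ?p' z"
    using att(3) hubs pz by (auto simp: leaves_def)
  have card_z: "card (leaves ?p' z) = 2" using att(3) b(16) by auto
  have leaves': "leaves ?p' w = leaves p w - {y}" if "w \<in> hubs ?p'" "w \<noteq> z" for w
    using att(4)[of w] that q'(1) by auto
  \<comment> \<open>Hubs of a tight block are adjacent only to hubs and to their own leaves, but
    \<open>?q\<close> is a leaf of \<open>z\<close>. Hence the loss of the hub \<open>?q\<close>
    does not affect their blocks.\<close>
  have not_adj_q: "\<not> E w ?q" if "v \<in> hubs ?p'" "tight_at ?p' N v" "w \<in> block ?p' v" "w \<noteq> z" for v N w
  proof
    assume "E w ?q"
    then have "?q \<in> nb V w" using b(11) hubs_subset by (auto simp: nb_def)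
    then have "?q \<in> leaves ?p' w \<union> nb (hubs ?p') w" using tight_at_full(1)[OF pre' deg that(1-3)] by simp
    then have "?q \<in> leaves ?p' w" using q'(1) by (auto simp: nb_def)
    then show False using q'(2) that(4) by (auto simp: leaves_def)
  qed
  have in_z: "z \<in> block ?p' v" if v: "v \<in> hubs ?p'" "tight_at ?p' N v" for v N
  proof (rule ccontr)
    assume n: "z \<notin> block ?p' v"
    then have vz: "v \<noteq> z" using self_in_block[of v ?p'] by auto
    have vh: "v \<in> hubs p" using v(1) vz hubs by auto
    show False
    proof (rule away[OF vh v(2)])
      fix w assume w: "w \<in> block ?p' v"
      have wz: "w \<noteq> z" using w n by auto
      have "block ?p' w = block ?p' v" using tight_atD(3)[OF v(2) w] .
      then have "z \<notin> block ?p' w" using n by simp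
      then show "block p w = block ?p' w"
        using not_adj_q[OF v w wz] by (auto simp: block_def nb_def hubs)
      have "w \<in> hubs ?p'" using block_subset[OF v(1)] w by blast
      then show "leaves ?p' w = leaves p w - {y}" using leaves' wz by blast
    qed
  qed
  have tight_z: "tight_at ?p' N z \<and> block ?p' v = block ?p' z" if v: "v \<in> hubs ?p'" "tight_at ?p' N v" for v N
    using tight_at_block[OF v(2) in_z[OF v]] tight_atD(3)[OF v(2) in_z[OF v]] by simp
  show uniq: "uniquely_tight ?p'"
    unfolding uniquely_tight_def using b(13) tight_z by metis
  obtain v N where v: "v \<in> hubs ?p'" "tight_at ?p' N v" using always_tight[OF b(13)] by auto
  have tzN: "tight_at ?p' N z" using tight_z[OF v] by blast
  have "N = 2" using tight_atD(4)[OF tzN, of z] card_z by simp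
  then have tz: "tight_at ?p' 2 z" using tzN by simp
  have zh: "z \<in> hubs ?p'" using hubs by simp
  define B where "B = block ?p' z"
  have cardB: "card B = 4" and finB: "finite B" and zB: "z \<in> B" using tight_atD(2)[OF tz] by (auto simp: B_def)
  have nonspecial: "\<not> special p w \<and> w \<in> hubs p" if w: "w \<in> B - {z}" for w
  proof -
    have wB: "w \<in> block ?p' z" "w \<noteq> z" using w by (auto simp: B_def)
    have wh': "w \<in> hubs ?p'" using block_subset[OF zh] wB by blast
    then have wh: "w \<in> hubs p" using wB hubs by auto
    have eqB: "block ?p' w = B" using tight_atD(3)[OF tz wB(1)] by (simp add: B_def)
    have block: "block p w = B - {z}"
      using not_adj_q[OF zh tz wB] eqB wB(2) z by (auto simp: block_def nb_def hubs)
    have two: "card (leaves p a) = 2" if a: "a \<in> B - {z}" for a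
    proof -
      have aB: "a \<in> block ?p' z" "a \<noteq> z" using a by (auto simp: B_def)
      then have "E a z" by (auto simp: block_def nb_def adj_commute)
      then have "a \<noteq> p y" using not_adj by auto
      moreover have "a \<in> hubs ?p'" using block_subset[OF zh] aB by blast
      ultimately have "leaves ?p' a = leaves p a" using leaves' aB(2) y_leaf[of a] by simp
      then show ?thesis using tight_atD(4)[OF tz aB(1)] by simp
    qed
    \<comment> \<open>With three hubs the block could be tight or pretight only for the value 3, but
      all its hubs have two leaves.\<close>
    have card3: "card (block p w) = 3" using block cardB finB zB by simp
    have "\<not> tight_at p K w" for K
      using card3 two[OF w] tight_atD(2)[of p K w] tight_atD(4)[of p K w w] by auto
    moreover have "\<not> pretight_at p K w" for K
    proof
      assume K: "pretight_at p K w"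
      then have "K = 3" using card3 pretight_atD(2)[OF K] by simp
      then obtain a where a: "\<forall>v\<in>block p w - {a}. card (leaves p v) = 3" using pretight_atD(4)[OF K] by blast
      have "card (block p w - {a}) \<ge> 2" using card3 by (simp add: card_Diff_singleton_if)
      then have "block p w - {a} \<noteq> {}" by (metis card.empty not_numeral_le_zero)
      then obtain c where c: "c \<in> block p w - {a}" by blast
      then show False using a two[of c] block by auto
    qed
    ultimately show ?thesis using wh by (auto simp: special_def)
  qed
  have sub: "u \<in> hubs p \<and> \<not> special p u \<and> u \<notin> B" if u: "u \<in> hubs ?p'" "\<not> special ?p' u" for u
  proof -
    have uB: "u \<notin> B" using tight_at_block[OF tz, of u] u(2) by (auto simp: B_def special_def)
    then have uz: "u \<noteq> z" using zB by auto
    then have uh: "u \<in> hubs p" "u \<noteq> ?q" using u(1) hubs by auto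
    have "\<not> special p u"
    proof
      assume sp: "special p u"
      have "special ?p' u"
      proof (cases "E ?q u")
        case True
        \<comment> \<open>A second, hypothetical shift: \<open>?q\<close> is now a leaf of the tight
          hub \<open>z\<close> and could be moved on to its neighbour \<open>u\<close>, so
          \<open>shift_hub\<close> shows that the block of \<open>u\<close> is pretight.\<close>
        have "u \<notin> block ?p' z" using uB by (simp add: B_def)
        then have "\<exists>N. pretight_at ?p' N u"
          using shift_hub(3)[OF uniq, of 2 ?q u] tz q'(2) True pz u(1) by (simp add: hubs_def)
        then show ?thesis by (auto simp: special_def)
      next
        case False
        have far: "\<not> E w z \<and> \<not> E w ?q \<and> w \<noteq> ?q \<and> w \<noteq> z \<and> w \<in> hubs p" if w: "w \<in> block p u" for w
        proof -
          have wh: "w \<in> hubs p" using block_subset[OF uh(1)] w by blast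
          have eq: "block p w = block p u" using special_block_eq[OF sp w] .
          have q_notin: "?q \<notin> block p u" using False uh(2) by (auto simp: block_def nb_def adj_commute)
          have wq: "w \<noteq> ?q" using w q_notin by auto
          have wz: "w \<noteq> z" using wh z by auto
          have "\<not> E w ?q" using adj_in_block[of w ?q p] b(11) eq q_notin by auto
          moreover have "\<not> E w z"
          proof
            assume "E w z"
            then have "w \<in> B" using wh wq adj_in_block[of z w ?p'] hubs by (auto simp: B_def adj_commute)
            then have "\<not> special p w" using nonspecial wz by blast
            then show False using special_block[OF sp w] by blast
          qed
          ultimately show ?thesis using wq wz wh by blast
        qed
        have block: "block ?p' w = block p w" if "w \<in> block p u" for w
          using far[OF that] by (auto simp: block_def nb_def hubs)
        have lv: "leaves ?p' w = leaves p w - {y}" if "w \<in> block p u" for w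
          using far[OF that] leaves'[of w] hubs by auto
        have bu: "block ?p' u = block p u" using block self_in_block by blast
        show ?thesis
        proof (cases "p y \<in> block p u")
          case True
          \<comment> \<open>Here the block of \<open>u\<close> is the old tight one; the loss of the
            leaf \<open>y\<close> has made it pretight.\<close>
          have eq: "block p (p y) = block p u" using special_block_eq[OF sp True] .
          have "pretight_at ?p' M u"
            unfolding pretight_at_def bu
          proof (intro conjI bexI[of _ "p y"] ballI)
            show "card (leaves ?p' (p y)) + 1 = M" using lv[OF True] b(8,14,15) by simp
            fix w assume w: "w \<in> block p u - {p y}"
            then show "card (leaves ?p' w) = M" using tight_atD(4)[OF tight, of w] eq lv[of w] y_leaf[of w] by simp
          next
            show "block ?p' w = block p u" if "w \<in> block p u" for w
              using block[OF that] special_block_eq[OF sp that] by simp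
          qed (use tight_atD(1,2)[OF tight] eq True in auto)
          then show ?thesis by (auto simp: special_def)
        next
          case F: False
          have "leaves ?p' w = leaves p w" if "w \<in> block p u" for w
            using lv[OF that] y_leaf[of w] F that by auto
          then show ?thesis using sp block special_cong(2)[of p u ?p'] by blast
        qed
      qed
      then show False using u(2) by blast
    qed
    then show ?thesis using uh uB by blast
  qed
  have "card (B - {z}) = 3" using cardB finB zB by simp
  then have "B - {z} \<noteq> {}" by (metis card.empty zero_neq_numeral)
  then obtain w where "w \<in> B - {z}" by blast
  then show "{u \<in> hubs ?p'. \<not> special ?p' u} \<subset> {u \<in> hubs p. \<not> special p u}"
    using sub nonspecial[of w] by blast
qed

end

end

end

subsection \<open>The bound for degree five\<close>

context fin_sgraph begin

text \<open>Among the uniquely tight partitions with the fewest non-special hubs, suppose such a hub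
  \<open>r\<close> remains, and take one of least weight with respect to the distance to
  \<open>r\<close>. A leaf of the tight block can be shifted towards \<open>r\<close>: onto a hub
  this lowers the weight, onto the only leaf of a star it lowers the number of non-special hubs, and
  onto any other leaf it is impossible.\<close>

lemma exists_all_special:
  assumes deg: "\<And>v. v \<in> V \<Longrightarrow> card (nb V v) \<le> 5"
    and always_tight: "\<And>p. star p \<Longrightarrow> \<exists>u\<in>hubs p. \<exists>M. tight_at p M u"
    and star: "star p0"
    and conn: "\<And>r. r \<in> V \<Longrightarrow> \<exists>d :: 'a \<Rightarrow> nat. \<forall>v\<in>V. v \<noteq> r \<longrightarrow> (\<exists>z. E v z \<and> d z < d v)"
  shows "\<exists>p. uniquely_tight p \<and> (\<forall>u\<in>hubs p. special p u)"
proof -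
  define bad where "bad p = {u \<in> hubs p. \<not> special p u}" for p
  have fin_bad: "finite (bad p)" for p by (simp add: bad_def)
  have pre: "prestar p" if "star p" for p using that by (simp add: star_def)
  have full: "nb V x \<subseteq> {w \<in> V. p w \<in> block p u} \<and> 2 \<le> card (leaves p x)"
    if "star p" "u \<in> hubs p" "tight_at p M u" "x \<in> block p u" for p u M x
    using tight_at_full(2,3)[OF pre[OF that(1)] deg that(2-4)] by blast
  obtain u0 where "u0 \<in> hubs p0" using always_tight[OF star] by blast
  then have "u0 \<in> V" using hubs_subset by blast
  then obtain d :: "'a \<Rightarrow> nat" where d: "\<And>v. v \<in> V \<Longrightarrow> v \<noteq> u0 \<Longrightarrow> \<exists>z. E v z \<and> d z < d v"
    using conn by blast
  obtain p1 where p1: "star p1"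
    and rooted: "\<And>Q. Q \<noteq> {} \<Longrightarrow> Q \<subseteq> hubs p1 \<Longrightarrow>
     (\<forall>x\<in>Q. nb V x \<subseteq> {w \<in> V. p1 w \<in> Q} \<and> 2 \<le> card (leaves p1 x)) \<Longrightarrow> p1 u0 \<in> Q"
    using exists_rooted_star[OF star d] by blast
  \<comment> \<open>All tight blocks contain the hub of the root and therefore coincide.\<close>
  have "block p1 u = block p1 (p1 u0)" if u: "u \<in> hubs p1" "tight_at p1 M u" for u M
  proof -
    have "p1 u0 \<in> block p1 u"
      using rooted[of "block p1 u"] full[OF p1 u] block_subset[OF u(1)] self_in_block by blast
    then show ?thesis by (rule tight_atD(3)[OF u(2), symmetric])
  qed
  then have "uniquely_tight p1" using p1 unfolding uniquely_tight_def by metis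
  then obtain p2 where p2: "uniquely_tight p2"
    and min_bad: "\<And>q. uniquely_tight q \<Longrightarrow> card (bad p2) \<le> card (bad q)"
    using ex_has_least_nat[of uniquely_tight p1 "\<lambda>p. card (bad p)"] by blast
  have "bad p2 = {}"
  proof (rule ccontr)
    assume "bad p2 \<noteq> {}"
    then obtain r where r: "r \<in> bad p2" by blast
    then have rV: "r \<in> V" using hubs_subset by (auto simp: bad_def)
    then obtain d :: "'a \<Rightarrow> nat" where d: "\<And>v. v \<in> V \<Longrightarrow> v \<noteq> r \<Longrightarrow> \<exists>z. E v z \<and> d z < d v"
      using conn by blast
    \<comment> \<open>Fixing the set of non-special hubs, not only its size, keeps \<open>r\<close>
      among them; so \<open>r\<close> stays a hub outside the tight block.\<close>
    define ok where "ok p \<longleftrightarrow> uniquely_tight p \<and> bad p = bad p2" for p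
    have "ok p2" using p2 by (simp add: ok_def)
    then obtain p where p: "ok p"
      and min: "\<And>q. ok q \<Longrightarrow> (\<Sum>v\<in>V. (4::nat) ^ d (p v)) \<le> (\<Sum>v\<in>V. 4 ^ d (q v))"
      using ex_has_least_nat[of ok p2 "\<lambda>p. \<Sum>v\<in>V. (4::nat) ^ d (p v)"] by blast
    have up: "uniquely_tight p" and bad: "bad p = bad p2" using p by (auto simp: ok_def)
    have sp: "star p" using up by (simp add: uniquely_tight_def)
    have prep: "prestar p" using pre[OF sp] .
    obtain u M where u: "u \<in> hubs p" "tight_at p M u" using always_tight[OF sp] by blast
    have r_bad: "r \<in> hubs p" "\<not> special p r" using r bad by (auto simp: bad_def)
    have "r \<notin> block p u" using r_bad(2) tight_at_block[OF u(2), of r] by (auto simp: special_def)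
    then have "p r \<notin> block p u" using r_bad(1) by (simp add: hubs_def)
    moreover have "block p u \<noteq> {}" using self_in_block by blast
    ultimately obtain y z where yz: "E y z" "p y \<in> block p u" "p y \<noteq> y" "p z \<notin> block p u" "d z < d (p y)"
      using exists_move_towards[OF prep block_subset[OF u(1)] _ _ d] full[OF sp u] by blast
    have ty: "tight_at p M (p y)" using tight_at_block[OF u(2) yz(2)] .
    have yz': "p z \<notin> block p (p y)" using yz(4) tight_atD(3)[OF u(2) yz(2)] by simp
    note shift = deg always_tight up ty yz(1,3) yz'
    show False
    proof (cases "z \<in> hubs p")
      case True
      have "bad (attach p y z) = bad p"
        using shift_hub(2,4)[OF shift True] unfolding bad_def by blast
      then have "ok (attach p y z)" using shift_hub(1)[OF shift True] bad by (simp add: ok_def)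
      moreover have "p z \<noteq> p y" using yz(2,4) by auto
      ultimately show False
        using min[of "attach p y z"] attach_weight[OF prep yz(1) _ leaves_nonhub[OF prep yz(3)], of d] yz(5)
        by simp
    next
      case False
      have single: "leaves p (p z) = {z}" using shift_leaf_impossible[OF shift False] by blast
      have "bad (attach p y z) \<subset> bad p"
        using shift_single_leaf(2)[OF shift False single] by (simp add: bad_def)
      then have "card (bad (attach p y z)) < card (bad p)" by (rule psubset_card_mono[OF fin_bad])
      then show False using min_bad[OF shift_single_leaf(1)[OF shift False single]] bad by simp
    qed
  qed
  then show ?thesis using p2 by (auto simp: bad_def)
qed

text \<open>In every block the first choice is exact up to the term \<open>5\<close>, which only the tight block
  needs; it is subtracted from the cost of a vertex \<open>c\<close> of that block.\<close>

lemma max_indep_all_special: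
  assumes star: "star p" and uniq: "uniquely_tight p" and all: "\<And>u. u \<in> hubs p \<Longrightarrow> special p u"
    and c: "c \<in> hubs p" "tight_at p N c"
  shows "\<exists>I. max_indep (hubs p) I \<and>
    (\<Sum>u\<in>hubs p. 5 * int (card (leaves p u)) - 6) \<le> (\<Sum>h\<in>I. 11 * (int (card (leaves p h)) - 1)) + 5"
proof -
  let ?X = "hubs p" and ?m = "\<lambda>u. int (card (leaves p u))"
  define cost where "cost u = 5 * ?m u - 6 - (if u = c then 5 else 0)" for u
  have "\<exists>I. max_indep ?X I \<and> sum cost ?X \<le> (\<Sum>h\<in>I. 11 * (?m h - 1))"
  \<comment> \<open>The invariant says that the remaining set is a union of whole blocks, so each
    choice removes exactly one block.\<close>
  proof (rule greedy_max_indep[where P = "closed_in ?X"])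
    show "closed_in ?X ?X" using nb_subset by (auto simp: closed_in_def)
    fix W assume W: "W \<subseteq> ?X" "W \<noteq> {}" "closed_in ?X W"
    then obtain u where u: "u \<in> W" by blast
    then have uX: "u \<in> ?X" using W by blast
    define B where "B = block p u"
    have BX: "B \<subseteq> ?X" using block_subset[OF uX] by (simp add: B_def)
    have beq: "block p v = B" if "v \<in> B" for v
      using that special_block_eq[OF all[OF uX], of v] unfolding B_def by blast
    have finB: "finite B" by (simp add: B_def)
    have sum_cost: "sum cost B = (\<Sum>v\<in>B. 5 * ?m v - 6) - (if c \<in> B then 5 else 0)"
      using finB by (simp add: cost_def sum_subtractf sum.delta)
    have "\<exists>h\<in>B. sum cost B \<le> 11 * (?m h - 1)"
    proof -
      from all[OF uX] consider M where "tight_at p M u" | M where "pretight_at p M u"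
        by (auto simp: special_def)
      then show ?thesis
      proof cases
        case (1 M)
        have "block p u = block p c" using uniq 1 uX c unfolding uniquely_tight_def by blast
        then have cB: "c \<in> B" using self_in_block[of c p] by (simp add: B_def)
        have m: "?m v = int M" if "v \<in> B" for v using tight_atD(4)[OF 1] that by (simp add: B_def)
        \<comment> \<open>This is \<open>4 * 4 - 5 = 11\<close> for \<open>M = 2\<close> and
          \<open>3 * 9 - 5 = 22\<close> for \<open>M = 3\<close>, in both cases equal to the
          gain.\<close>
        have "sum cost B = int (card B) * (5 * int M - 6) - 5" using sum_cost cB m by simp
        then have "sum cost B \<le> 11 * (?m u - 1)"
          using tight_atD(1,2)[OF 1] m[of u] by (auto simp: B_def)
        then show ?thesis using B_def self_in_block by blast
      next
        case (2 M)
        then obtain w where w: "w \<in> B" "card (leaves p w) + 1 = M"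
          "\<And>v. v \<in> B - {w} \<Longrightarrow> card (leaves p v) = M"
          using pretight_atD(4)[OF 2] by (auto simp: B_def)
        have "3 \<le> card B" using pretight_atD(1,2)[OF 2] by (auto simp: B_def)
        then have "card (B - {w}) \<noteq> 0" using w(1) finB by simp
        \<comment> \<open>A hub with all \<open>M\<close> leaves must be chosen, not the deficient
          \<open>w\<close>. The cost is then \<open>-1 + 3 * 4 = 11\<close> for \<open>M = 2\<close>
          and \<open>4 + 2 * 9 = 22\<close> for \<open>M = 3\<close>, again equal to the
          gain.\<close>
        then obtain h where h: "h \<in> B - {w}" by (metis card.empty ex_in_conv)
        have "(\<Sum>v\<in>B - {w}. 5 * ?m v - 6) = int (card (B - {w})) * (5 * int M - 6)" using w(3) by simp
        then have "(\<Sum>v\<in>B. 5 * ?m v - 6) = 5 * ?m w - 6 + int (card (B - {w})) * (5 * int M - 6)"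
          using sum.remove[OF finB w(1), of "\<lambda>v. 5 * ?m v - 6"] by simp
        moreover have "int (card (B - {w})) = 5 - int M"
          using w(1) finB pretight_atD(1,2)[OF 2] by (auto simp: B_def)
        moreover have "?m w = int M - 1" using w(2) by linarith
        ultimately have "(\<Sum>v\<in>B. 5 * ?m v - 6) = 5 * (int M - 1) - 6 + (5 - int M) * (5 * int M - 6)" by simp
        then have "(\<Sum>v\<in>B. 5 * ?m v - 6) \<le> 11 * (int M - 1)" using pretight_atD(1)[OF 2] by auto
        then have "sum cost B \<le> 11 * (?m h - 1)" using sum_cost w(3)[OF h] by simp
        then show ?thesis using h by blast
      qed
    qed
    then obtain h where h: "h \<in> B" "sum cost B \<le> 11 * (?m h - 1)" by blast
    have "nb ?X u \<subseteq> W" using W(3) u by (auto simp: closed_in_def)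
    then have BW: "B \<subseteq> W" using u by (simp add: B_def block_def)
    then have "nb W h = nb ?X h" using closed_in_nb[OF W(3)] h(1) by blast
    then have cnb: "cnb W {h} = B" using beq[OF h(1)] by (simp add: block_def)
    have "closed_in ?X (W - B)"
      unfolding closed_in_def
    proof (intro conjI ballI subsetI)
      fix v w assume v: "v \<in> W - B" and w: "w \<in> nb ?X v"
      have "w \<in> W" using W(3) v w by (auto simp: closed_in_def)
      moreover have "w \<notin> B"
      proof
        assume wB: "w \<in> B"
        have vX: "v \<in> ?X" using v W(1) by blast
        have "v \<in> block p w" using block_sym[OF _ vX, of w] w by (simp add: block_def)
        then show False using beq[OF wB] v by blast
      qed
      ultimately show "w \<in> W - B" by blast
    qed (use W(1) in blast)
    then show "\<exists>J. J \<noteq> {} \<and> J \<subseteq> W \<and> indep J \<and> sum cost (cnb W J) \<le> (\<Sum>h\<in>J. 11 * (?m h - 1))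
        \<and> closed_in ?X (W - cnb W J)"
      using h BW cnb by (intro exI[of _ "{h}"]) auto
  qed simp
  moreover have "sum cost ?X = (\<Sum>u\<in>?X. 5 * ?m u - 6) - 5"
    using c(1) by (simp add: cost_def sum_subtractf sum.delta)
  ultimately show ?thesis by (metis diff_le_eq)
qed

text \<open>If some star partition has no tight block, the measure for \<open>5 / 9\<close> applies
  to it. Otherwise \<open>always_tight\<close> holds and a partition into special blocks gives the
  bound with \<open>f = 6\<close> and \<open>f + 5 = 11\<close>.\<close>

lemma max_indep_bound_5:
  assumes deg: "\<And>v. v \<in> V \<Longrightarrow> card (nb V v) \<le> 5"
    and iso: "\<And>v. v \<in> V \<Longrightarrow> \<exists>w. E v w"
    and conn: "\<And>r. r \<in> V \<Longrightarrow> \<exists>d :: 'a \<Rightarrow> nat. \<forall>v\<in>V. v \<noteq> r \<longrightarrow> (\<exists>z. E v z \<and> d z < d v)"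
  shows "\<exists>S. max_indep V S \<and> (9 * card S \<le> 5 * card V \<or> 11 * card S \<le> 6 * card V + 5)"
proof -
  obtain p0 where p0: "star p0" using star_exists iso by blast
  let ?m = "\<lambda>p x. card (leaves p x)"
  show ?thesis
  proof (cases "\<exists>p. star p \<and> (\<forall>u\<in>hubs p. \<forall>M. \<not> tight_at p M u)")
    case True
    then obtain p where p: "star p" and nt: "\<And>u M. u \<in> hubs p \<Longrightarrow> \<not> tight_at p M u" by blast
    have pre: "prestar p" using p by (simp add: star_def)
    have "\<exists>I. max_indep (hubs p) I \<and>
        (\<Sum>u\<in>hubs p. 4 * int (?m p u) - 5) \<le> (\<Sum>h\<in>I. 9 * (int (?m p h) - 1))"
    proof (rule weighted_greedy_no_tight_clique[OF finite_hubs])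
      show "1 \<le> ?m p u" if "u \<in> hubs p" for u using star_leaves_pos[OF p that] .
      show "?m p u + card (nb (hubs p) u) \<le> 5" if "u \<in> hubs p" for u
        using hub_neighbours(3)[OF pre that] deg[of u] that by (auto simp: hubs_def)
      show "\<not> tight_clique (?m p) (hubs p) Q" for Q
      proof
        assume Q: "tight_clique (?m p) (hubs p) Q"
        then obtain u where "u \<in> Q" by (auto simp: tight_clique_def tight_set_def)
        then show False using tight_clique_tight_at[OF Q] nt by blast
      qed
    qed
    then obtain I where I: "max_indep (hubs p) I"
      "(\<Sum>u\<in>hubs p. 4 * int (?m p u) - 5) \<le> (\<Sum>h\<in>I. 9 * (int (?m p h) - 1))" by blast
    have "\<exists>S. max_indep V S \<and> (4 + 5) * int (card S) \<le> 5 * int (card V) + 0"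
      using I(2) by (intro max_indep_of_weighted_bound[OF pre _ I(1)]) auto
    then obtain S where "max_indep V S" "9 * card S \<le> 5 * card V" by auto
    then show ?thesis by blast
  next
    case False
    then have at: "\<And>p. star p \<Longrightarrow> \<exists>u\<in>hubs p. \<exists>M. tight_at p M u" by blast
    obtain p where p: "uniquely_tight p" "\<And>u. u \<in> hubs p \<Longrightarrow> special p u"
      using exists_all_special[OF deg at p0 conn] by blast
    have sp: "star p" using p(1) by (simp add: uniquely_tight_def)
    have pre: "prestar p" using sp by (simp add: star_def)
    obtain c N where c: "c \<in> hubs p" "tight_at p N c" using at[OF sp] by blast
    obtain I where I: "max_indep (hubs p) I"
      "(\<Sum>u\<in>hubs p. 5 * int (?m p u) - 6) \<le> (\<Sum>h\<in>I. 11 * (int (?m p h) - 1)) + 5"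
      using max_indep_all_special[OF sp p c] by blast
    have "\<exists>S. max_indep V S \<and> (5 + 6) * int (card S) \<le> 6 * int (card V) + 5"
      using I(2) by (intro max_indep_of_weighted_bound[OF pre _ I(1)]) auto
    then obtain S where "max_indep V S" "11 * card S \<le> 6 * card V + 5" by auto
    then show ?thesis by blast
  qed
qed

end

subsection \<open>Independent dominating sets\<close>

text \<open>The length of a shortest walk to \<open>r\<close> decreases along the first step of such
  a walk.\<close>

lemma reachable_distance:
  assumes "\<And>v. v \<in> V \<Longrightarrow> (v, r) \<in> R\<^sup>*"
  shows "\<exists>d :: 'a \<Rightarrow> nat. \<forall>v\<in>V. v \<noteq> r \<longrightarrow> (\<exists>z. (v, z) \<in> R \<and> d z < d v)"
proof -
  define d where "d v = (LEAST n. (v, r) \<in> R ^^ n)" for v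
  have "\<exists>z. (v, z) \<in> R \<and> d z < d v" if v: "v \<in> V" "v \<noteq> r" for v
  proof -
    obtain n where "(v, r) \<in> R ^^ n" using rtrancl_imp_relpow[OF assms[OF v(1)]] by blast
    then have dv: "(v, r) \<in> R ^^ d v" unfolding d_def by (rule LeastI)
    then have "d v \<noteq> 0" using v(2) by (metis relpow_0_E)
    then obtain k where k: "d v = Suc k" using not0_implies_Suc by blast
    then obtain z where z: "(v, z) \<in> R" "(z, r) \<in> R ^^ k" using dv relpow_Suc_D2 by metis
    have "d z \<le> k" unfolding d_def using z(2) by (rule Least_le)
    then show ?thesis using z(1) k by auto
  qed
  then show ?thesis by blast
qed

lemma (in fin_sgraph) max_indep_single:
  assumes "V = {v}"
  shows "max_indep V {v}"
  using assms by (simp add: max_indep_def)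

theorem theorem1p1:
  fixes G :: "'a pair_pre_digraph" and \<Delta> :: nat
  assumes "\<Delta> \<ge> 4"
    and "pair_graph G"
    and "Digraph_Component.connected (with_proj G)"
    and "max_degree G \<le> \<Delta>"
  shows "(\<Delta> \<noteq> 5 \<longrightarrow>
           (\<exists>S. independent_dominating_set G S \<and>
              real (card S) \<le>
                (1 - real \<Delta> / (real_of_int \<lfloor>(real \<Delta>)\<^sup>2 / 4\<rfloor> + real \<Delta>)) * (real (card (pverts G)) - 1) + 1))
       \<and> (\<Delta> = 5 \<longrightarrow>
           (\<exists>S. independent_dominating_set G S \<and>
              real (card S) \<le>
                max (5 / 9 * real (card (pverts G)))
                  ((1 - real \<Delta> / (real_of_int \<lfloor>(real \<Delta>)\<^sup>2 / 4\<rfloor> + real \<Delta>)) * (real (card (pverts G)) - 1) + 1)))"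
proof -
  interpret pair_graph G by (rule assms(2))
  let ?V = "pverts G" and ?n = "real (card (pverts G))"
  interpret H: fin_sgraph "\<lambda>u v. (u, v) \<in> parcs G" ?V
  proof
    show "(u, v) \<in> parcs G \<Longrightarrow> (v, u) \<in> parcs G" for u v
      using arcs_symmetric by blast
    show "(v, v) \<notin> parcs G" for v
      using no_loops'[of v v] by blast
  qed (use finite_verts in_arcsD1 in auto)
  have deg: "card (H.nb ?V v) \<le> \<Delta>" if v: "v \<in> ?V" for v
  proof -
    have "inj_on snd (out_arcs (with_proj G) v)" by (auto simp: out_arcs_def inj_on_def)
    moreover have "snd ` out_arcs (with_proj G) v = H.nb ?V v"
      using in_arcsD2 by (force simp: out_arcs_def H.nb_def)
    ultimately have "card (H.nb ?V v) = out_degree (with_proj G) v"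
      unfolding out_degree_def by (metis card_image)
    also have "\<dots> \<le> max_degree G"
      unfolding max_degree_def using v finite_verts by (intro Max_ge) auto
    finally show ?thesis using assms(4) by simp
  qed
  have "strongly_connected (with_proj G)"
    using assms(3) sym_arcs by (intro symmetric_connected_imp_strongly_connected)
  then have ne: "?V \<noteq> {}" and "\<And>u v. u \<in> ?V \<Longrightarrow> v \<in> ?V \<Longrightarrow> u \<rightarrow>\<^sup>*\<^bsub>with_proj G\<^esub> v"
    unfolding strongly_connected_def by simp_all
  then have reach: "(u, v) \<in> (parcs G)\<^sup>*" if "u \<in> ?V" "v \<in> ?V" for u v
    using reachable_rtranclI[of "with_proj G" u v] that by simp
  have conn: "\<exists>d :: 'a \<Rightarrow> nat. \<forall>v\<in>?V. v \<noteq> r \<longrightarrow> (\<exists>z. (v, z) \<in> parcs G \<and> d z < d v)" if "r \<in> ?V" for r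
    using reachable_distance[of ?V r "parcs G"] reach that by blast
  have ids: "independent_dominating_set G S" if "H.max_indep ?V S" for S
    using that unfolding independent_dominating_set_def independent_set_def dominating_set_def
      H.max_indep_def H.indep_def by auto
  define f where "f = \<Delta>\<^sup>2 div 4"
  have "(real \<Delta>)\<^sup>2 / 4 = real (\<Delta>\<^sup>2) / real 4" by simp
  then have f: "real_of_int \<lfloor>(real \<Delta>)\<^sup>2 / 4\<rfloor> = real f"
    unfolding f_def by (simp only: floor_divide_of_nat_eq of_int_of_nat_eq)
  have pos: "0 < real f + real \<Delta>" using assms(1) by simp
  have bound: "(1 - real \<Delta> / (real f + real \<Delta>)) * (?n - 1) + 1 = (real f * ?n + real \<Delta>) / (real f + real \<Delta>)"
    using pos by (simp add: field_simps)
  have "\<exists>S. H.max_indep ?V S \<and> ((f + \<Delta>) * card S \<le> f * card ?V + \<Delta> \<or> \<Delta> = 5 \<and> 9 * card S \<le> 5 * card ?V)"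
  proof (cases "card ?V = 1")
    case True
    \<comment> \<open>A single vertex admits no star partition; it attains the bound with
      equality.\<close>
    then obtain v where v: "?V = {v}" by (auto simp: card_1_singleton_iff)
    show ?thesis using H.max_indep_single[OF v] True by (intro exI[of _ "{v}"]) simp
  next
    case False
    have iso: "\<exists>w. (v, w) \<in> parcs G" if v: "v \<in> ?V" for v
    proof -
      have "?V \<noteq> {v}" using False by auto
      then obtain r where "r \<in> ?V" "v \<noteq> r" using v by auto
      then show ?thesis using conn v by blast
    qed
    show ?thesis
    proof (cases "\<Delta> = 5")
      case True
      have "\<exists>S. H.max_indep ?V S \<and> (9 * card S \<le> 5 * card ?V \<or> 11 * card S \<le> 6 * card ?V + 5)"
        using deg True by (intro H.max_indep_bound_5 iso conn) auto
      then show ?thesis using True by (auto simp: f_def)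
    next
      case ne5: False
      obtain r where r: "r \<in> ?V" using ne by blast
      then obtain d :: "'a \<Rightarrow> nat"
        where d: "\<And>v. v \<in> ?V \<Longrightarrow> v \<noteq> r \<Longrightarrow> \<exists>z. (v, z) \<in> parcs G \<and> d z < d v"
        using conn by blast
      obtain S where S: "H.max_indep ?V S" "(int f + int \<Delta>) * int (card S) \<le> int f * int (card ?V) + int \<Delta>"
        using H.max_indep_bound_not_5[OF assms(1) ne5 deg iso d] unfolding f_def by blast
      have "int ((f + \<Delta>) * card S) \<le> int (f * card ?V + \<Delta>)" using S(2) by simp
      then show ?thesis using S(1) by (auto simp only: of_nat_le_iff)
    qed
  qed
  then obtain S where S: "H.max_indep ?V S"
    "(f + \<Delta>) * card S \<le> f * card ?V + \<Delta> \<or> \<Delta> = 5 \<and> 9 * card S \<le> 5 * card ?V" by blast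
  have "real (card S) \<le> (real f * ?n + real \<Delta>) / (real f + real \<Delta>)"
    if "(f + \<Delta>) * card S \<le> f * card ?V + \<Delta>"
  proof -
    have "real ((f + \<Delta>) * card S) \<le> real (f * card ?V + \<Delta>)" using that by (simp only: of_nat_le_iff)
    then show ?thesis using pos by (simp add: pos_le_divide_eq mult.commute)
  qed
  moreover have "real (card S) \<le> 5 / 9 * ?n" if "9 * card S \<le> 5 * card ?V"
    using that by linarith
  ultimately show ?thesis
    unfolding f bound using S(2) ids[OF S(1)] by (intro conjI impI exI[of _ S]) (auto simp: le_max_iff_disj)
qed

end
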